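(* Let $\alpha>0$ and $x\in(0,1)$. For each $n\in\mathbb{N}$ let $S_{\alpha,x}^{(n)}$ be a random variable whose law is the $\alpha$-fractional binomial distribution $\mu_{\alpha,x}^{(n)}$. Let $\{c_n\}_{n=1}^\infty$ be a sequence of positive real numbers such that $$\lim_{n\to\infty}\frac{c_n}{n}=0\quad\text{and}\quad\lim_{n\to\infty}\frac{c_n}{\sqrt n}=+\infty,$$ and set $Y_{\alpha,x}^{(n)}:=\dfrac{S_{\alpha,x}^{(n)}-nx}{c_n}$ for $n\in\mathbb{N}$. Then the sequence of laws of $Y_{\alpha,x}^{(n)}$, $n\in\mathbb{N}$, satisfies the moderate deviation principle with speed $c_n^2/n$ and quadratic rate function $$I_{\alpha,x}^{(\mathrm{M})}(z)=\frac{\alpha}{2x(1-x)}z^2,\qquad z\in\mathbb{R}.$$ Namely, the following two properties hold. (1) For any closed set $F\subset\mathbb{R}$, $$\limsup_{n\to\infty}\frac{n}{c_n^2}\log\mathbb{P}\left(Y_{\alpha,x}^{(n)}\in F\right)\le-\inf_{z\in F}I_{\alpha,x}^{(\mathrm{M})}(z).$$ (2) For any open set $G\subset\mathbb{R}$, $$\liminf_{n\to\infty}\frac{n}{c_n^2}\log\mathbb{P}\left(Y_{\alpha,x}^{(n)}\in G\right)\ge-\inf_{z\in G}I_{\alpha,x}^{(\mathrm{M})}(z).$$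
   Context: $\mathbb{N}=\{1,2,3,\dots\}$. For real $w>-1$ and $z$ with $-1<z<w+1$, $\binom{w}{z}:=\frac{\Gamma(w+1)}{\Gamma(z+1)\Gamma(w-z+1)}$, where $\Gamma$ is the gamma function. For $\alpha>0$, $n\in\mathbb{N}$, $x\in[0,1]$, the $\alpha$-fractional binomial distribution $\mu_{\alpha,x}^{(n)}$ is the probability measure on $\{0,1,\dots,n\}$ defined by $$\mu_{\alpha,x}^{(n)}=\frac{\alpha}{Z_{\alpha,x}^{(n)}}\sum_{j=0}^n\binom{\alpha n}{\alpha j}x^{\alpha j}(1-x)^{\alpha(n-j)}\delta_j,\qquad Z_{\alpha,x}^{(n)}=\alpha\sum_{j=0}^n\binom{\alpha n}{\alpha j}x^{\alpha j}(1-x)^{\alpha(n-j)},$$ where $\delta_j$ is the Dirac measure at $j$ (and $0^0=1$). Conventions: $\log 0=-\infty$, $\inf\emptyset=+\infty$. *)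

theory Defs
  imports "HOL-Probability.Probability"
begin

text \<open>Binomial coefficient with real arguments; meaningful for \<open>w > -1\<close> and \<open>-1 < z < w + 1\<close>,
  where all three arguments of \<open>Gamma\<close> are positive.\<close>

definition real_binomial :: "real \<Rightarrow> real \<Rightarrow> real" where
  "real_binomial w z = Gamma (w + 1) / (Gamma (z + 1) * Gamma (w - z + 1))"

text \<open>\<open>powr\<close> has \<open>0 powr 0 = 0\<close>, whereas the distribution below uses \<open>0\<^sup>0 = 1\<close>
  (relevant at the endpoints \<open>x = 0\<close> and \<open>x = 1\<close>).\<close>

definition rpow :: "real \<Rightarrow> real \<Rightarrow> real" where
  "rpow x a = (if x = 0 \<and> a = 0 then 1 else x powr a)"

definition frac_binomial_weight :: "real \<Rightarrow> nat \<Rightarrow> real \<Rightarrow> nat \<Rightarrow> real" where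
  "frac_binomial_weight \<alpha> n x j =
     real_binomial (\<alpha> * real n) (\<alpha> * real j)
       * rpow x (\<alpha> * real j) * rpow (1 - x) (\<alpha> * (real n - real j))"

definition frac_binomial_Z :: "real \<Rightarrow> nat \<Rightarrow> real \<Rightarrow> real" where
  "frac_binomial_Z \<alpha> n x = \<alpha> * (\<Sum>j=0..n. frac_binomial_weight \<alpha> n x j)"

definition frac_binomial :: "real \<Rightarrow> nat \<Rightarrow> real \<Rightarrow> nat measure" where
  "frac_binomial \<alpha> n x =
     point_measure {0..n}
       (\<lambda>j. ennreal (\<alpha> / frac_binomial_Z \<alpha> n x * frac_binomial_weight \<alpha> n x j))"

text \<open>Logarithm of a probability, with \<open>log 0 = -\<infinity>\<close> (the library's \<open>ln\<close> on the reals
  has \<open>ln 0 = 0\<close>).\<close>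

definition log_prob :: "real \<Rightarrow> ereal" where
  "log_prob p = (if p = 0 then - \<infinity> else ereal (ln p))"

definition mdp_rate :: "real \<Rightarrow> real \<Rightarrow> real \<Rightarrow> real" where
  "mdp_rate \<alpha> x z = \<alpha> / (2 * x * (1 - x)) * z\<^sup>2"

lemma frac_binomial_weight_nonneg:
  assumes "\<alpha> > 0" "j \<le> n"
  shows "frac_binomial_weight \<alpha> n x j \<ge> 0"
proof -
  have "\<alpha> * real n - \<alpha> * real j \<ge> 0"
    using assms by (simp add: mult_left_mono)
  then show ?thesis
    using assms
    by (auto simp: frac_binomial_weight_def real_binomial_def rpow_def
             intro!: mult_nonneg_nonneg divide_nonneg_nonneg less_imp_le[OF Gamma_real_pos]
                     add_nonneg_pos)
qed

lemma frac_binomial_Z_pos: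
  assumes "\<alpha> > 0" "0 \<le> x" "x \<le> 1"
  shows "frac_binomial_Z \<alpha> n x > 0"
proof -
  define k where "k = (if x = 0 then 0 else n)"
  have k: "k \<in> {0..n}" by (simp add: k_def)
  have "real_binomial (\<alpha> * real n) (\<alpha> * real k) > 0"
  proof -
    have "Gamma (\<alpha> * real n + 1) > 0"
      using assms by (intro Gamma_real_pos add_nonneg_pos) auto
    then show ?thesis
      by (auto simp: k_def real_binomial_def)
  qed
  moreover have "rpow x (\<alpha> * real k) > 0" "rpow (1 - x) (\<alpha> * (real n - real k)) > 0"
    using assms by (auto simp: k_def rpow_def)
  ultimately have "frac_binomial_weight \<alpha> n x k > 0"
    by (simp add: frac_binomial_weight_def)
  then have "(\<Sum>j=0..n. frac_binomial_weight \<alpha> n x j) > 0"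
    by (intro sum_pos2[OF _ k]) (auto intro: frac_binomial_weight_nonneg assms)
  then show ?thesis
    using assms by (simp add: frac_binomial_Z_def)
qed

lemma prob_space_frac_binomial:
  assumes "\<alpha> > 0" "0 \<le> x" "x \<le> 1"
  shows "prob_space (frac_binomial \<alpha> n x)"
proof
  let ?w = "\<lambda>j. \<alpha> / frac_binomial_Z \<alpha> n x * frac_binomial_weight \<alpha> n x j"
  have Z: "frac_binomial_Z \<alpha> n x > 0" by (rule frac_binomial_Z_pos[OF assms])
  have "emeasure (frac_binomial \<alpha> n x) (space (frac_binomial \<alpha> n x))
          = (\<Sum>j\<in>{0..n}. ennreal (?w j))"
    by (simp add: frac_binomial_def space_point_measure emeasure_point_measure_finite)
  also have "\<dots> = ennreal (\<Sum>j\<in>{0..n}. ?w j)"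
    using assms Z by (intro sum_ennreal mult_nonneg_nonneg frac_binomial_weight_nonneg) auto
  also have "(\<Sum>j\<in>{0..n}. ?w j) = 1"
  proof -
    have "(\<Sum>j=0..n. frac_binomial_weight \<alpha> n x j) \<noteq> 0"
      using Z by (auto simp: frac_binomial_Z_def)
    then show ?thesis
      using assms by (simp add: sum_divide_distrib[symmetric] frac_binomial_Z_def)
  qed
  finally show "emeasure (frac_binomial \<alpha> n x) (space (frac_binomial \<alpha> n x)) = 1"
    by simp
qed

end

theory Submission
  imports Defs
begin

text \<open>With \<open>u = j - n x\<close> and \<open>\<kappa> = \<alpha> / (x (1 - x))\<close>, log-convexity of Gamma gives that the log-ratio
  of consecutive weights decreases in \<open>j\<close> and equals \<open>- \<kappa> u / n + o(c\<^sub>n / n)\<close> uniformly for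
  \<open>u = O(c\<^sub>n)\<close>. Summing the ratios, the weights on this range are, up to a common factor,
  \<open>exp (- (c\<^sub>n\<^sup>2 / n) (\<kappa> (u / c\<^sub>n)\<^sup>2 / 2 + o(1)))\<close>, and beyond it they are dominated by a geometric
  series with about \<open>n / c\<^sub>n\<close> effective terms, negligible against \<open>c\<^sub>n\<close> because
  \<open>c\<^sub>n\<^sup>2 / n \<longlonglongrightarrow> \<infinity>\<close>. All windows of width proportional to \<open>c\<^sub>n\<close> contain comparably many
  points, so probabilities are compared without knowing the normalising constant, and neither
  Stirling's formula nor a moment generating function is needed.\<close>

section \<open>Convexity bounds for increments of the logarithm of Gamma\<close>

text \<open>The points \<open>s + h\<close> and \<open>t\<close> are convex combinations of
  \<open>s\<close> and \<open>t + h\<close> with interchanged weights; adding the two convexity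
  inequalities makes the weights disappear.\<close>

lemma convex_on_increment_mono:
  fixes f :: "real \<Rightarrow> real"
  assumes f: "convex_on I f" and I: "s \<in> I" "t + h \<in> I" and "s \<le> t" "0 < h"
  shows "f (s + h) - f s \<le> f (t + h) - f t"
proof -
  define a where "a = (t - s) / (t + h - s)"
  have pos: "t + h - s > 0" using assms by simp
  have a: "0 \<le> a" "a \<le> 1" using assms pos by (auto simp: a_def field_simps)
  have aa: "a * (t + h - s) = t - s" using pos by (simp add: a_def)
  have 1: "s + h = a * s + (1 - a) * (t + h)" using aa by (simp add: algebra_simps)
  have 2: "t = (1 - a) * s + a * (t + h)" using aa by (simp add: algebra_simps)
  have cv: "f (u * s + v * (t + h)) \<le> u * f s + v * f (t + h)"
    if "0 \<le> u" "0 \<le> v" "u + v = 1" for u v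
    using f I that unfolding convex_on_def by auto
  have "f (s + h) \<le> a * f s + (1 - a) * f (t + h)"
    unfolding 1 using a by (intro cv) auto
  moreover have "f t \<le> (1 - a) * f s + a * f (t + h)"
    by (subst 2, rule cv) (use a in auto)
  ultimately show ?thesis by (simp add: algebra_simps)
qed

text \<open>One lattice step shifts a Gamma argument in the weights by \<open>\<alpha>\<close>, so
  the log-ratios of consecutive weights are made of these increments.\<close>

definition lnGamma_diff :: "real \<Rightarrow> real \<Rightarrow> real" where
  "lnGamma_diff \<alpha> t = ln (Gamma (t + \<alpha>)) - ln (Gamma t)"

lemma lnGamma_diff_mono:
  assumes "\<alpha> > 0" "0 < s" "s \<le> t"
  shows "lnGamma_diff \<alpha> s \<le> lnGamma_diff \<alpha> t"
  using convex_on_increment_mono[OF log_convex_Gamma_real, of s t \<alpha>] assms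
  by (simp add: lnGamma_diff_def)

lemma ln_Gamma_plus1_real:
  fixes t :: real
  assumes "t > 0"
  shows "ln (Gamma (t + 1)) = ln (Gamma t) + ln t"
proof -
  have "t \<notin> \<int>\<^sub>\<le>\<^sub>0" using assms by (auto elim!: nonpos_Ints_cases')
  then show ?thesis using assms Gamma_real_pos[OF assms] by (simp add: Gamma_plus1 ln_mult del: Gamma_real_pos)
qed

text \<open>By convexity the chord slope from \<open>t\<close> to \<open>t + \<alpha>\<close> is at
  most the slope of the adjacent unit chord from \<open>t + \<alpha>\<close>, which the functional
  equation evaluates to \<open>ln (t + \<alpha>)\<close>.\<close>

lemma lnGamma_diff_upper:
  assumes "\<alpha> > 0" "0 < t"
  shows "lnGamma_diff \<alpha> t \<le> \<alpha> * ln (t + \<alpha>)"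
proof -
  define f where "f = (ln \<circ> Gamma :: real \<Rightarrow> real)"
  have cv: "convex_on {0<..} f" unfolding f_def by (rule log_convex_Gamma_real)
  have "(f t - f (t + \<alpha>)) / (t - (t + \<alpha>)) \<le> (f t - f (t + \<alpha> + 1)) / (t - (t + \<alpha> + 1))"
    "(f t - f (t + \<alpha> + 1)) / (t - (t + \<alpha> + 1)) \<le>
      (f (t + \<alpha>) - f (t + \<alpha> + 1)) / ((t + \<alpha>) - (t + \<alpha> + 1))"
    using assms by (intro convex_on_slope_le[OF cv]; simp)+
  then have "(f t - f (t + \<alpha>)) / (t - (t + \<alpha>)) \<le> (f (t + \<alpha>) - f (t + \<alpha> + 1)) / ((t + \<alpha>) - (t + \<alpha> + 1))"
    by (rule order_trans)
  also have "\<dots> = ln (t + \<alpha>)"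
    using ln_Gamma_plus1_real[of "t + \<alpha>"] assms by (simp add: f_def)
  finally show ?thesis using assms by (simp add: f_def lnGamma_diff_def field_simps)
qed

text \<open>The unit chord from \<open>t\<close> has slope \<open>ln t\<close> and precedes the
  chord of length \<open>\<alpha>\<close> from \<open>t + 1\<close>. The shift by one fits the
  arguments \<open>\<alpha> * real j + 1\<close> in the weights, with
  \<open>t = \<alpha> * real j\<close>.\<close>

lemma lnGamma_diff_lower:
  assumes "\<alpha> > 0" "0 < t"
  shows "\<alpha> * ln t \<le> lnGamma_diff \<alpha> (t + 1)"
proof -
  define f where "f = (ln \<circ> Gamma :: real \<Rightarrow> real)"
  have cv: "convex_on {0<..} f" unfolding f_def by (rule log_convex_Gamma_real)
  have "ln t = (f t - f (t + 1)) / (t - (t + 1))"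
    using ln_Gamma_plus1_real[of "t"] assms by (simp add: f_def)
  also have "\<dots> \<le> (f t - f (t + 1 + \<alpha>)) / (t - (t + 1 + \<alpha>))"
    using assms by (intro convex_on_slope_le[OF cv]; simp)
  also have "\<dots> \<le> (f (t + 1) - f (t + 1 + \<alpha>)) / ((t + 1) - (t + 1 + \<alpha>))"
    using assms by (intro convex_on_slope_le[OF cv]; simp)
  finally show ?thesis using assms by (simp add: f_def lnGamma_diff_def field_simps)
qed

section \<open>Moderate scales and linearised Gamma increments\<close>

locale moderate_scale =
  fixes c :: "nat \<Rightarrow> real"
  assumes c_pos: "n \<ge> 1 \<Longrightarrow> c n > 0"
    and c_sublinear: "(\<lambda>n. c n / real n) \<longlonglongrightarrow> 0"
    and c_supersqrt: "filterlim (\<lambda>n. c n / sqrt (real n)) at_top sequentially"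
begin

lemma eventually_c_over_n_le:
  assumes "e > 0"
  shows "eventually (\<lambda>n. c n / real n \<le> e) sequentially"
  using order_tendstoD(2)[OF c_sublinear assms] by eventually_elim simp

lemma eventually_c_ge: "eventually (\<lambda>n. c n \<ge> K) sequentially"
proof -
  have "eventually (\<lambda>n. c n / sqrt (real n) \<ge> max K 0) sequentially"
    using c_supersqrt unfolding filterlim_at_top by blast
  then show ?thesis using eventually_ge_at_top[of 1]
  proof eventually_elim
    case (elim n)
    have "max K 0 * 1 \<le> max K 0 * sqrt (real n)" using elim by (intro mult_left_mono) auto
    also have "\<dots> \<le> c n" using elim by (subst (asm) pos_le_divide_eq) auto
    finally show ?case by simp
  qed
qed

lemma eventually_speed_ge: "eventually (\<lambda>n. (c n)\<^sup>2 / real n \<ge> K) sequentially"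
proof -
  have "eventually (\<lambda>n. c n / sqrt (real n) \<ge> max K 1) sequentially"
    using c_supersqrt unfolding filterlim_at_top by blast
  then show ?thesis using eventually_ge_at_top[of 1]
  proof eventually_elim
    case (elim n)
    have "K \<le> max K 1 * max K 1"
      using mult_mono[of 1 "max K 1" K "max K 1"] by (cases "K \<ge> 0") (auto intro: order_trans)
    also have "\<dots> \<le> (c n / sqrt (real n)) * (c n / sqrt (real n))"
      using elim(1) by (intro mult_mono) linarith+
    also have "\<dots> = (c n)\<^sup>2 / real n" by (simp add: power2_eq_square)
    finally show ?case .
  qed
qed

text \<open>With \<open>b = \<alpha> * real n * y\<close>, the chord bounds trap the increment
  between \<open>\<alpha> * ln (b * (1 + s))\<close> and
  \<open>\<alpha> * ln (b * (1 + s'))\<close>, where \<open>s\<close> and \<open>s'\<close> are of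
  order \<open>c n / real n\<close>. The quadratic error of the logarithm and the gap
  \<open>s' - s\<close>, of order \<open>1 / real n\<close>, are both negligible on that
  scale.\<close>

lemma lnGamma_diff_linearized:
  assumes "\<alpha> > 0" "y > 0" "R \<ge> 0" "e > 0"
  shows "eventually (\<lambda>n. \<forall>j::nat. \<bar>real j - real n * y\<bar> \<le> R * c n \<longrightarrow>
      \<bar>lnGamma_diff \<alpha> (\<alpha> * real j + 1) - \<alpha> * ln (\<alpha> * real n * y)
        - \<alpha> * (real j - real n * y) / (real n * y)\<bar> \<le> e * c n / real n) sequentially"
proof -
  \<comment> \<open>Chosen so that
    \<open>\<alpha> * real j + 1 + \<alpha> = \<alpha> * (real j + K)\<close>; then
    \<open>T * (c n / real n)\<close> bounds both relative deviations \<open>s\<close> and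
    \<open>s'\<close> as soon as \<open>c n \<ge> 1\<close>.\<close>
  define K where "K = 1 + 1 / \<alpha>"
  define T where "T = (R + K) / y"
  have K: "K \<ge> 1" using assms by (simp add: K_def)
  have T: "T > 0" using assms K by (simp add: T_def)
  \<comment> \<open>The first bound keeps \<open>s\<close> and \<open>s'\<close> within
    \<open>1/2\<close>, where the logarithm estimate applies. The second lets the quadratic error
    use half of the allowance \<open>e\<close>; \<open>B\<close> leaves the other half to the gap
    between \<open>s\<close> and \<open>s'\<close>.\<close>
  define d where "d = min (1 / (2 * T)) (e / (4 * \<alpha> * T\<^sup>2))"
  have d: "d > 0" using T assms by (simp add: d_def)
  define B where "B = max 1 (2 * \<alpha> * K / (e * y))"
  show ?thesis
    using eventually_c_over_n_le[OF d] eventually_c_ge[of B] eventually_ge_at_top[of 1]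
  proof eventually_elim
    case (elim n)
    define q where "q = c n / real n"
    have n: "real n > 0" using elim by simp
    have c1: "c n \<ge> 1" "c n \<ge> 2 * \<alpha> * K / (e * y)" using elim by (auto simp: B_def)
    have q: "q > 0" using c1 n by (simp add: q_def)
    have Tq: "T * q \<le> 1/2"
    proof -
      have "q \<le> 1 / (2 * T)" using elim by (simp add: q_def d_def)
      then show ?thesis using T by (simp add: field_simps)
    qed
    have sq: "2 * \<alpha> * (T * q)\<^sup>2 \<le> e / 2 * q"
    proof -
      have "q \<le> e / (4 * \<alpha> * T\<^sup>2)" using elim by (simp add: q_def d_def)
      then have "q * (4 * \<alpha> * T\<^sup>2) \<le> e" using T assms by (simp add: pos_le_divide_eq)
      then have "q * (4 * \<alpha> * T\<^sup>2) * q \<le> e * q" using q by (intro mult_right_mono) auto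
      then show ?thesis by (simp add: power2_eq_square algebra_simps)
    qed
    have lin: "\<alpha> * K / (real n * y) \<le> e / 2 * q"
    proof -
      have "2 * \<alpha> * K \<le> c n * (e * y)" using c1 assms by (simp add: pos_divide_le_eq)
      then show ?thesis using assms n by (simp add: q_def field_simps)
    qed
    show ?case
    proof (intro allI impI)
      fix j :: nat
      assume j: "\<bar>real j - real n * y\<bar> \<le> R * c n"
      define u where "u = real j - real n * y"
      define s where "s = u / (real n * y)"
      define s' where "s' = (u + K) / (real n * y)"
      define b where "b = \<alpha> * real n * y"
      have b: "b > 0" using assms n by (simp add: b_def)
      have bnd: "\<bar>v / (real n * y)\<bar> \<le> T * q" if "\<bar>v\<bar> \<le> R * c n + K" for v
      proof -
        have "\<bar>v\<bar> \<le> R * c n + K * c n" using that K c1 mult_left_mono[of 1 "c n" K] by linarith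
        then have "\<bar>v\<bar> / (real n * y) \<le> (R * c n + K * c n) / (real n * y)"
          using n assms by (intro divide_right_mono) auto
        then show ?thesis using n assms by (simp add: T_def q_def field_simps)
      qed
      have s: "\<bar>s\<bar> \<le> T * q" unfolding s_def using j K by (intro bnd) (auto simp: u_def)
      have s': "\<bar>s'\<bar> \<le> T * q" unfolding s'_def using j K by (intro bnd) (auto simp: u_def)
      have sqs: "r\<^sup>2 \<le> (T * q)\<^sup>2" if "\<bar>r\<bar> \<le> T * q" for r
        using that T q by (metis abs_le_square_iff abs_of_nonneg abs_ge_zero order_trans)
      have jb: "\<alpha> * real j = b * (1 + s)" "\<alpha> * real j + 1 + \<alpha> = b * (1 + s')"
        using assms n by (auto simp: b_def s_def s'_def u_def K_def field_simps)
      have p: "1 + s > 0" "1 + s' > 0" using s s' Tq by auto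
      have "\<alpha> * real j > 0" unfolding jb using b p by simp
      have ln1: "\<bar>ln (1 + s) - s\<bar> \<le> 2 * (T * q)\<^sup>2"
        using abs_ln_one_plus_x_minus_x_bound[of s] s Tq sqs[of s] by linarith
      have ln2: "\<bar>ln (1 + s') - s'\<bar> \<le> 2 * (T * q)\<^sup>2"
        using abs_ln_one_plus_x_minus_x_bound[of s'] s' Tq sqs[of s'] by linarith
      have "\<alpha> * ln (\<alpha> * real j) \<le> lnGamma_diff \<alpha> (\<alpha> * real j + 1)"
        using \<open>\<alpha> * real j > 0\<close> assms by (intro lnGamma_diff_lower) auto
      moreover have "ln (\<alpha> * real j) = ln b + ln (1 + s)"
        unfolding jb using b p by (simp add: ln_mult)
      moreover have "\<alpha> * ln (1 + s) \<ge> \<alpha> * (s - 2 * (T * q)\<^sup>2)"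
        using ln1 assms by (intro mult_left_mono) auto
      ultimately have lower: "lnGamma_diff \<alpha> (\<alpha> * real j + 1) \<ge> \<alpha> * ln b + \<alpha> * s - 2 * \<alpha> * (T * q)\<^sup>2"
        by (simp add: algebra_simps)
      have "lnGamma_diff \<alpha> (\<alpha> * real j + 1) \<le> \<alpha> * ln (\<alpha> * real j + 1 + \<alpha>)"
        using \<open>\<alpha> * real j > 0\<close> assms by (intro lnGamma_diff_upper) auto
      moreover have "ln (\<alpha> * real j + 1 + \<alpha>) = ln b + ln (1 + s')"
        unfolding jb(2) using b p by (simp add: ln_mult)
      moreover have "\<alpha> * ln (1 + s') \<le> \<alpha> * (s' + 2 * (T * q)\<^sup>2)"
        using ln2 assms by (intro mult_left_mono) auto
      moreover have "s' = s + K / (real n * y)" by (simp add: s_def s'_def add_divide_distrib)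
      ultimately have upper: "lnGamma_diff \<alpha> (\<alpha> * real j + 1) \<le>
          \<alpha> * ln b + \<alpha> * s + \<alpha> * K / (real n * y) + 2 * \<alpha> * (T * q)\<^sup>2"
        by (simp add: algebra_simps)
      have "\<bar>lnGamma_diff \<alpha> (\<alpha> * real j + 1) - \<alpha> * ln b - \<alpha> * s\<bar> \<le> e * q"
        using lower upper sq lin mult_pos_pos[OF assms(4) q] unfolding abs_le_iff by linarith
      then show "\<bar>lnGamma_diff \<alpha> (\<alpha> * real j + 1) - \<alpha> * ln (\<alpha> * real n * y)
        - \<alpha> * (real j - real n * y) / (real n * y)\<bar> \<le> e * c n / real n"
        by (simp add: b_def s_def u_def q_def)
    qed
  qed
qed

end

section \<open>Counting lattice points and telescoping\<close>

lemma card_nat_between_ge: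
  fixes a b :: real
  assumes "0 \<le> a"
  shows "b - a - 1 \<le> real (card {j::nat. a \<le> real j \<and> real j \<le> b})"
proof (cases "b < 0")
  case False
  have "{j::nat. a \<le> real j \<and> real j \<le> b} = {nat \<lceil>a\<rceil>..nat \<lfloor>b\<rfloor>}"
    using False assms by (auto simp: le_nat_iff le_floor_iff nat_le_iff ceiling_le_iff)
  then show ?thesis using False assms by simp linarith
qed (use assms in auto)

lemma card_nat_between_le:
  fixes a b :: real
  assumes "a \<le> b" "0 \<le> b"
  shows "real (card {j::nat. a \<le> real j \<and> real j \<le> b}) \<le> b - a + 1"
proof -
  have "{j::nat. a \<le> real j \<and> real j \<le> b} = {nat \<lceil>a\<rceil>..nat \<lfloor>b\<rfloor>}"
    using assms by (auto simp: le_nat_iff le_floor_iff nat_le_iff ceiling_le_iff)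
  then show ?thesis using assms by simp linarith
qed

lemma abs_diff_le_of_steps:
  fixes g :: "nat \<Rightarrow> real"
  assumes "i \<le> j" "\<And>k. i \<le> k \<Longrightarrow> k < j \<Longrightarrow> \<bar>g (Suc k) - g k\<bar> \<le> D"
  shows "\<bar>g j - g i\<bar> \<le> real (j - i) * D"
  using assms
proof (induction j rule: dec_induct)
  case (step j)
  have "\<bar>g j - g i\<bar> \<le> real (j - i) * D" using step by simp
  moreover have "\<bar>g (Suc j) - g j\<bar> \<le> D" using step by simp
  moreover have "real (Suc j - i) * D = real (j - i) * D + D"
    using step by (simp add: Suc_diff_le algebra_simps)
  ultimately show ?case by linarith
qed simp

section \<open>Gaussian shape of log-concave weights near the centre\<close>

text \<open>Isolates what the argument needs from the weights. These properties are inherited by the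
  weights reflected under \<open>j \<mapsto> n - j\<close>, so that only one tail has to be
  estimated.\<close>

locale log_concave_mdp = moderate_scale c for c :: "nat \<Rightarrow> real" +
  fixes w :: "nat \<Rightarrow> nat \<Rightarrow> real" and x \<kappa> :: real
  assumes x: "0 < x" "x < 1" and \<kappa>: "0 < \<kappa>"
    and w_pos: "j \<le> n \<Longrightarrow> w n j > 0"
    and log_ratio_antimono: "i \<le> j \<Longrightarrow> j < n \<Longrightarrow>
      ln (w n (Suc j)) - ln (w n j) \<le> ln (w n (Suc i)) - ln (w n i)"
    and log_ratio_linearized: "R \<ge> 0 \<Longrightarrow> e > 0 \<Longrightarrow>
      eventually (\<lambda>n. \<forall>j<n. \<bar>real j - real n * x\<bar> \<le> R * c n \<longrightarrow>
        \<bar>ln (w n (Suc j)) - ln (w n j) + \<kappa> * (real j - real n * x) / real n\<bar> \<le> e * c n / real n)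
      sequentially"
begin

definition Y :: "nat \<Rightarrow> nat \<Rightarrow> real" where
  "Y n j = (real j - real n * x) / c n"

definition mass :: "nat \<Rightarrow> real set \<Rightarrow> real" where
  "mass n B = (\<Sum>j | j \<le> n \<and> Y n j \<in> B. w n j)"

text \<open>What is left of the log-weight after its Gaussian part is removed; the aim is to show
  that it is almost constant on windows of width of order \<open>c n\<close>.\<close>

definition potential :: "nat \<Rightarrow> nat \<Rightarrow> real" where
  "potential n j = ln (w n j) + \<kappa> * (real j - real n * x)\<^sup>2 / (2 * real n)"

text \<open>The common factor of all weights, read off at the lattice point just below the centre.
  It takes the place of an explicit normalising constant and is later eliminated.\<close>

definition peak :: "nat \<Rightarrow> real" where
  "peak n = exp (potential n (nat \<lfloor>real n * x\<rfloor>))"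

lemma peak_pos: "peak n > 0" by (simp add: peak_def)

lemma mass_nonneg: "mass n B \<ge> 0"
  unfolding mass_def by (intro sum_nonneg) (auto intro: less_imp_le w_pos)

lemma mass_mono: "B \<subseteq> C \<Longrightarrow> mass n B \<le> mass n C"
  unfolding mass_def by (intro sum_mono2) (auto intro: less_imp_le w_pos)

lemma mass_UNIV_pos: "mass n UNIV > 0"
  unfolding mass_def by (intro sum_pos2[of _ n]) (auto intro: less_imp_le w_pos)

lemma mass_Un_le: "mass n (B \<union> C) \<le> mass n B + mass n C"
proof -
  have "mass n (B \<union> C) = sum (w n) ({j. j \<le> n \<and> Y n j \<in> B} \<union> {j. j \<le> n \<and> Y n j \<in> C})"
    unfolding mass_def by (rule sum.cong) auto
  also have "\<dots> \<le> mass n B + mass n C"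
    unfolding mass_def by (subst sum.union_inter[symmetric])
      (auto intro!: sum_nonneg less_imp_le[OF w_pos])
  finally show ?thesis .
qed

text \<open>The increment of the quadratic term cancels the linear part of the log-ratio. The
  remaining \<open>\<kappa> / (2 * real n)\<close>, from expanding \<open>(u + 1)\<^sup>2\<close>,
  is absorbed because \<open>c n\<close> is eventually large.\<close>

lemma potential_step:
  assumes "R \<ge> 0" "e > 0"
  shows "eventually (\<lambda>n. \<forall>j<n. \<bar>real j - real n * x\<bar> \<le> R * c n \<longrightarrow>
    \<bar>potential n (Suc j) - potential n j\<bar> \<le> e * c n / real n) sequentially"
  using log_ratio_linearized[OF assms(1) half_gt_zero[OF assms(2)]] eventually_c_ge[of "\<kappa> / e"]
    eventually_ge_at_top[of 1]
proof eventually_elim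
  case (elim n)
  have n: "real n > 0" using elim by simp
  have "\<kappa> \<le> e * c n" using elim assms by (simp add: field_simps)
  then have k: "\<kappa> / (2 * real n) \<le> e * c n / real n / 2"
    using n by (simp add: field_simps)
  have k0: "\<kappa> / (2 * real n) \<ge> 0" using \<kappa> by simp
  show ?case
  proof (intro allI impI)
    fix j assume j: "j < n" "\<bar>real j - real n * x\<bar> \<le> R * c n"
    define u where "u = real j - real n * x"
    have "\<kappa> * (u + 1)\<^sup>2 / (2 * real n) = \<kappa> * u\<^sup>2 / (2 * real n) + \<kappa> * u / real n + \<kappa> / (2 * real n)"
      using n by (simp add: field_simps power2_eq_square)
    then have "potential n (Suc j) - potential n j
        = (ln (w n (Suc j)) - ln (w n j) + \<kappa> * u / real n) + \<kappa> / (2 * real n)"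
      by (simp add: potential_def u_def algebra_simps)
    moreover have "\<bar>ln (w n (Suc j)) - ln (w n j) + \<kappa> * u / real n\<bar> \<le> e * c n / real n / 2"
      using elim j by (simp add: u_def algebra_simps)
    moreover have "\<bar>d\<bar> \<le> q" if "d = l + p" "\<bar>l\<bar> \<le> q / 2" "0 \<le> p" "p \<le> q / 2" for d l p q :: real
      using that by linarith
    ultimately show "\<bar>potential n (Suc j) - potential n j\<bar> \<le> e * c n / real n"
      using k k0 by blast
  qed
qed

lemma potential_diff:
  assumes "R \<ge> 0" "e > 0"
  shows "eventually (\<lambda>n. \<forall>i j. i \<le> j \<longrightarrow> j \<le> n \<longrightarrow> \<bar>real i - real n * x\<bar> \<le> R * c n \<longrightarrow>
    \<bar>real j - real n * x\<bar> \<le> R * c n \<longrightarrow>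
    \<bar>potential n j - potential n i\<bar> \<le> e * ((c n)\<^sup>2 / real n)) sequentially"
proof -
  \<comment> \<open>At most \<open>2 * R * c n\<close> steps are summed; the extra \<open>1\<close>
    keeps the denominator positive when \<open>R = 0\<close>.\<close>
  define e' where "e' = e / (2 * R + 1)"
  have e': "e' > 0" using assms by (simp add: e'_def)
  show ?thesis
    using potential_step[OF assms(1) e'] eventually_ge_at_top[of 1]
  proof eventually_elim
    case (elim n)
    have n: "real n > 0" "c n > 0" using elim c_pos by auto
    show ?case
    proof (intro allI impI)
      fix i j assume ij: "i \<le> j" "j \<le> n" "\<bar>real i - real n * x\<bar> \<le> R * c n"
        "\<bar>real j - real n * x\<bar> \<le> R * c n"
      have "\<bar>potential n j - potential n i\<bar> \<le> real (j - i) * (e' * c n / real n)"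
      proof (rule abs_diff_le_of_steps[OF ij(1)])
        fix k assume k: "i \<le> k" "k < j"
        then have "real i \<le> real k" "real k \<le> real j" by simp_all
        then have "\<bar>real k - real n * x\<bar> \<le> R * c n" using ij(3,4) by linarith
        then show "\<bar>potential n (Suc k) - potential n k\<bar> \<le> e' * c n / real n"
          using elim k ij by simp
      qed
      also have "\<dots> \<le> ((2 * R + 1) * c n) * (e' * c n / real n)"
        using ij n e' by (intro mult_right_mono) (auto simp: algebra_simps of_nat_diff)
      also have "\<dots> = e * ((c n)\<^sup>2 / real n)"
        using assms by (simp add: e'_def power2_eq_square)
      finally show "\<bar>potential n j - potential n i\<bar> \<le> e * ((c n)\<^sup>2 / real n)" .
    qed
  qed
qed

text \<open>Compares the potential at \<open>j\<close> with that at the centre. The condition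
  \<open>R \<ge> 1\<close> puts the rounded centre, at distance below one from
  \<open>real n * x\<close>, inside the window once \<open>c n \<ge> 1\<close>.\<close>

lemma weight_gaussian:
  assumes "R \<ge> 1" "e > 0"
  shows "eventually (\<lambda>n. \<forall>j\<le>n. \<bar>Y n j\<bar> \<le> R \<longrightarrow>
    peak n * exp (- ((c n)\<^sup>2 / real n) * (\<kappa> * (Y n j)\<^sup>2 / 2 + e)) \<le> w n j \<and>
    w n j \<le> peak n * exp (- ((c n)\<^sup>2 / real n) * (\<kappa> * (Y n j)\<^sup>2 / 2 - e))) sequentially"
proof -
  have "R \<ge> 0" using assms by simp
  show ?thesis
    using potential_diff[OF \<open>R \<ge> 0\<close> assms(2)] eventually_c_ge[of 1] eventually_ge_at_top[of 1]
  proof eventually_elim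
    case (elim n)
    define i where "i = nat \<lfloor>real n * x\<rfloor>"
    define m where "m = (c n)\<^sup>2 / real n"
    have n: "real n > 0" "c n > 0" using elim c_pos by auto
    have fl: "0 \<le> \<lfloor>real n * x\<rfloor>" using x n by simp
    have ireal: "real i = of_int \<lfloor>real n * x\<rfloor>" using fl by (simp add: i_def)
    have Rc: "1 \<le> R * c n" using elim assms mult_mono[of 1 R 1 "c n"] by simp
    have i: "\<bar>real i - real n * x\<bar> \<le> R * c n" using Rc unfolding ireal by linarith
    have "real n * x \<le> real n" using x n by simp
    then have "real i \<le> real n" unfolding ireal by linarith
    then have in': "i \<le> n" by simp
    show ?case
    proof (intro allI impI)
      fix j assume j: "j \<le> n" "\<bar>Y n j\<bar> \<le> R"
      have j': "\<bar>real j - real n * x\<bar> \<le> R * c n"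
        using j n by (simp add: Y_def abs_divide pos_divide_le_eq)
      have "\<bar>potential n j - potential n i\<bar> \<le> e * m"
        using elim(1) i in' j j' linear[of i j] unfolding m_def by (metis abs_minus_commute)
      moreover have "potential n j = ln (w n j) + m * (\<kappa> * (Y n j)\<^sup>2 / 2)"
        using n by (simp add: potential_def Y_def m_def field_simps power2_eq_square)
      ultimately have "potential n i + - m * (\<kappa> * (Y n j)\<^sup>2 / 2 + e) \<le> ln (w n j)"
        "ln (w n j) \<le> potential n i + - m * (\<kappa> * (Y n j)\<^sup>2 / 2 - e)"
        by (simp_all add: abs_le_iff algebra_simps)
      then have "exp (potential n i + - m * (\<kappa> * (Y n j)\<^sup>2 / 2 + e)) \<le> exp (ln (w n j))"
        "exp (ln (w n j)) \<le> exp (potential n i + - m * (\<kappa> * (Y n j)\<^sup>2 / 2 - e))"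
        unfolding exp_le_cancel_iff by blast+
      then show "peak n * exp (- ((c n)\<^sup>2 / real n) * (\<kappa> * (Y n j)\<^sup>2 / 2 + e)) \<le> w n j \<and>
        w n j \<le> peak n * exp (- ((c n)\<^sup>2 / real n) * (\<kappa> * (Y n j)\<^sup>2 / 2 - e))"
        using w_pos[OF j(1)] unfolding exp_add by (simp add: peak_def i_def m_def)
    qed
  qed
qed

section \<open>Masses of windows in units of the peak\<close>

text \<open>Each of the at least \<open>\<rho> * c n\<close> lattice points of the window weighs no
  less than the Gaussian bound at the largest possible deviation
  \<open>\<bar>z\<bar> + \<rho>\<close>.\<close>

lemma window_mass_ge:
  assumes "\<rho> > 0" "e > 0"
  shows "eventually (\<lambda>n. mass n {z-\<rho>..z+\<rho>} \<ge>
    \<rho> * c n * (peak n * exp (- ((c n)\<^sup>2 / real n) * (\<kappa> * (\<bar>z\<bar> + \<rho>)\<^sup>2 / 2 + e)))) sequentially"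
proof -
  define R where "R = \<bar>z\<bar> + \<rho> + 1"
  \<comment> \<open>Forces \<open>R * c n\<close> below the distances from the centre to
    \<open>0\<close> and to \<open>real n\<close>, so the window loses no points to the constraint
    \<open>0 \<le> j \<le> n\<close>.\<close>
  define d where "d = min x (1 - x) / R"
  have R: "R \<ge> 1" using assms by (simp add: R_def)
  have d: "d > 0" using x R by (simp add: d_def)
  show ?thesis
    using weight_gaussian[OF R assms(2)] eventually_c_over_n_le[OF d]
      eventually_c_ge[of "1 / \<rho>"] eventually_ge_at_top[of 1]
  proof eventually_elim
    case (elim n)
    define m where "m = (c n)\<^sup>2 / real n"
    have n: "real n > 0" "c n > 0" using elim c_pos by auto
    have m: "m \<ge> 0" using n by (simp add: m_def)
    define a b where "a = real n * x + (z - \<rho>) * c n" and "b = real n * x + (z + \<rho>) * c n"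
    have "R * c n \<le> min x (1 - x) * real n" using elim(2) n R unfolding d_def
      by (simp add: pos_divide_le_eq) (simp add: field_simps)
    moreover have "min x (1 - x) * real n \<le> x * real n" "min x (1 - x) * real n \<le> (1 - x) * real n"
      using n by (intro mult_right_mono; simp)+
    moreover have "- (z - \<rho>) * c n \<le> R * c n" "(z + \<rho>) * c n \<le> R * c n"
      using n assms by (intro mult_right_mono; simp add: R_def)+
    ultimately have ab: "0 \<le> a" "b \<le> real n" by (simp_all add: a_def b_def algebra_simps)
    have idx: "{j. j \<le> n \<and> Y n j \<in> {z-\<rho>..z+\<rho>}} = {j. a \<le> real j \<and> real j \<le> b}"
      using ab n by (auto simp: Y_def a_def b_def field_simps)
    \<comment> \<open>The window has length \<open>2 * \<rho> * c n\<close>; half of it pays for the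
      \<open>- 1\<close> in the lattice point count.\<close>
    have "1 \<le> \<rho> * c n" using elim assms by (simp add: field_simps)
    then have "\<rho> * c n \<le> b - a - 1" by (simp add: a_def b_def algebra_simps)
    also have "\<dots> \<le> real (card {j. a \<le> real j \<and> real j \<le> b})"
      using ab by (intro card_nat_between_ge)
    finally have card: "\<rho> * c n \<le> real (card {j. j \<le> n \<and> Y n j \<in> {z-\<rho>..z+\<rho>}})" unfolding idx .
    let ?v = "peak n * exp (- m * (\<kappa> * (\<bar>z\<bar> + \<rho>)\<^sup>2 / 2 + e))"
    have "\<rho> * c n * ?v \<le> real (card {j. j \<le> n \<and> Y n j \<in> {z-\<rho>..z+\<rho>}}) * ?v"
      using card peak_pos[of n] by (intro mult_right_mono) auto
    also have "\<dots> \<le> mass n {z-\<rho>..z+\<rho>}"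
      unfolding mass_def
    proof (rule sum_bounded_below)
      fix j assume j: "j \<in> {j. j \<le> n \<and> Y n j \<in> {z-\<rho>..z+\<rho>}}"
      then have Yj: "\<bar>Y n j\<bar> \<le> \<bar>z\<bar> + \<rho>" by auto
      then have "(Y n j)\<^sup>2 \<le> (\<bar>z\<bar> + \<rho>)\<^sup>2" by (metis abs_ge_zero order_trans power2_abs power_mono)
      then have "m * (\<kappa> * (Y n j)\<^sup>2 / 2 + e) \<le> m * (\<kappa> * (\<bar>z\<bar> + \<rho>)\<^sup>2 / 2 + e)"
        using m \<kappa> by (intro mult_left_mono) auto
      then have "?v \<le> peak n * exp (- m * (\<kappa> * (Y n j)\<^sup>2 / 2 + e))"
        using peak_pos[of n] by simp
      also have "\<dots> \<le> w n j" using elim j Yj by (simp add: m_def R_def)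
      finally show "?v \<le> w n j" .
    qed
    finally show ?case by (simp add: m_def)
  qed
qed

text \<open>The window has at most \<open>2 * c n + 1\<close> points, and the Gaussian factor is
  simply bounded by one.\<close>

lemma central_mass_le:
  assumes "e > 0"
  shows "eventually (\<lambda>n. mass n {-1..1} \<le> 3 * c n * (peak n * exp ((c n)\<^sup>2 / real n * e))) sequentially"
  using weight_gaussian[OF order_refl assms] eventually_c_ge[of 1] eventually_ge_at_top[of 1]
proof eventually_elim
  case (elim n)
  define m where "m = (c n)\<^sup>2 / real n"
  have n: "real n > 0" "c n > 0" using elim c_pos by auto
  have m: "m \<ge> 0" using n by (simp add: m_def)
  define J where "J = {j::nat. real n * x - c n \<le> real j \<and> real j \<le> real n * x + c n}"
  have sub: "{j. j \<le> n \<and> Y n j \<in> {-1..1}} \<subseteq> J"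
    using n by (auto simp: Y_def J_def field_simps)
  have "finite J" unfolding J_def
    by (rule finite_subset[of _ "{..nat \<lfloor>real n * x + c n\<rfloor>}"]) (auto simp: le_nat_floor)
  have "real (card {j. j \<le> n \<and> Y n j \<in> {-1..1}}) \<le> real (card J)"
    using card_mono[OF \<open>finite J\<close> sub] by simp
  also have "\<dots> \<le> real n * x + c n - (real n * x - c n) + 1"
    unfolding J_def using n x by (intro card_nat_between_le) auto
  also have "\<dots> \<le> 3 * c n" using elim by simp
  finally have card: "real (card {j. j \<le> n \<and> Y n j \<in> {-1..1}}) \<le> 3 * c n" .
  have "mass n {-1..1} \<le> real (card {j. j \<le> n \<and> Y n j \<in> {-1..1}}) * (peak n * exp (m * e))"
    unfolding mass_def
  proof (rule sum_bounded_above)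
    fix j assume j: "j \<in> {j. j \<le> n \<and> Y n j \<in> {-1..1}}"
    then have "w n j \<le> peak n * exp (- m * (\<kappa> * (Y n j)\<^sup>2 / 2 - e))"
      using elim by (auto simp: m_def abs_le_iff)
    also have "\<dots> \<le> peak n * exp (m * e)"
      using peak_pos[of n] m \<kappa> by (simp add: algebra_simps)
    finally show "w n j \<le> peak n * exp (m * e)" .
  qed
  also have "\<dots> \<le> 3 * c n * (peak n * exp (m * e))"
    using card peak_pos[of n] by (intro mult_right_mono) auto
  finally show ?case by (simp add: m_def)
qed

section \<open>Tail bounds by geometric series\<close>

text \<open>Linearisation is available only on windows, but antitone log-ratios carry the slope at
  the first tail point over to every later one. The tail is thus dominated by a geometric series
  with ratio \<open>exp (- t)\<close>, whose sum is at most
  \<open>1 + 1 / t \<le> c n\<close>.\<close>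

lemma right_tail_mass_le_peak:
  assumes "a > 0" "e > 0"
  shows "eventually (\<lambda>n. mass n {a..} \<le>
    c n * (peak n * exp (- ((c n)\<^sup>2 / real n) * (\<kappa> * a\<^sup>2 / 2 - e)))) sequentially"
proof -
  define R where "R = a + 1"
  have R: "R \<ge> 1" "R \<ge> 0" using assms by (simp_all add: R_def)
  \<comment> \<open>Keeps the window away from the right end, so that the first tail point
    \<open>k\<close> satisfies \<open>k < n\<close> and has a successor.\<close>
  have d: "(1 - x) / (2 * R) > 0" using x R by simp
  \<comment> \<open>An error of half the leading slope \<open>\<kappa> * a\<close>: the log-ratio at
    \<open>k\<close> is then still at most \<open>- t\<close>.\<close>
  have e1: "\<kappa> * a / 2 > 0" using \<kappa> assms by simp
  show ?thesis
    using weight_gaussian[OF R(1) assms(2)] log_ratio_linearized[OF R(2) e1]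
      eventually_c_over_n_le[OF d] eventually_c_ge[of 2]
      eventually_speed_ge[of "4 / (\<kappa> * a)"] eventually_ge_at_top[of 1]
  proof eventually_elim
    case (elim n)
    define m where "m = (c n)\<^sup>2 / real n"
    have n: "real n > 0" "c n > 0" using elim c_pos by auto
    have m: "m \<ge> 0" using n by (simp add: m_def)
    \<comment> \<open>The first index with \<open>a \<le> Y n k\<close>. Rounding up moves it by at
      most one, which the choice \<open>R = a + 1\<close> accommodates.\<close>
    define k where "k = nat \<lceil>real n * x + a * c n\<rceil>"
    have "0 \<le> real n * x + a * c n" using n x assms by simp
    then have "0 \<le> \<lceil>real n * x + a * c n\<rceil>" by linarith
    then have kreal: "real k = of_int \<lceil>real n * x + a * c n\<rceil>" by (simp add: k_def)
    have k1: "real n * x + a * c n \<le> real k" unfolding kreal by linarith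
    have "real k \<le> real n * x + a * c n + 1" unfolding kreal by linarith
    also have "\<dots> \<le> real n * x + R * c n" using elim by (simp add: R_def algebra_simps)
    finally have k2: "real k \<le> real n * x + R * c n" .
    have "R * c n \<le> (1 - x) / 2 * real n" using elim n R by (simp add: field_simps)
    also have "\<dots> < (1 - x) * real n" using n x by simp
    finally have "real k < real n" using k2 by (simp add: algebra_simps)
    then have kn: "k < n" by simp
    have Yk: "a \<le> Y n k" "Y n k \<le> R" using k1 k2 n by (simp_all add: Y_def field_simps)
    have Yk2: "a\<^sup>2 \<le> (Y n k)\<^sup>2" using Yk assms by (intro power_mono) auto
    have "w n k \<le> peak n * exp (- m * (\<kappa> * (Y n k)\<^sup>2 / 2 - e))"
      using elim kn Yk assms by (simp add: m_def)
    also have "\<dots> \<le> peak n * exp (- m * (\<kappa> * a\<^sup>2 / 2 - e))"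
      using peak_pos[of n] mult_left_mono[of "\<kappa> * a\<^sup>2 / 2 - e" "\<kappa> * (Y n k)\<^sup>2 / 2 - e" m] m Yk2 \<kappa>
      by simp
    finally have wk: "w n k \<le> peak n * exp (- m * (\<kappa> * a\<^sup>2 / 2 - e))" .
    define t where "t = \<kappa> * a / 2 * c n / real n"
    have t: "t > 0" using e1 n by (simp add: t_def)
    have "\<bar>real k - real n * x\<bar> \<le> R * c n"
      using k1 k2 assms n by (simp add: abs_le_iff) (smt (verit) mult_nonneg_nonneg)
    then have "ln (w n (Suc k)) - ln (w n k) + \<kappa> * (real k - real n * x) / real n \<le> t"
      using elim kn by (auto simp: t_def abs_le_iff)
    moreover have "\<kappa> * (a * c n) / real n \<le> \<kappa> * (real k - real n * x) / real n"
      using k1 n \<kappa> by (intro divide_right_mono mult_left_mono) auto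
    moreover have "\<kappa> * (a * c n) / real n = 2 * t" by (simp add: t_def)
    ultimately have slope: "ln (w n (Suc k)) - ln (w n k) \<le> - t" by linarith
    have geo: "w n (k + i) \<le> w n k * exp (- t) ^ i" if "k + i \<le> n" for i
      using that
    proof (induction i)
      case (Suc i)
      have "ln (w n (Suc (k + i))) - ln (w n (k + i)) \<le> - t"
        using log_ratio_antimono[of k "k + i" n] Suc slope by simp
      then have "exp (ln (w n (Suc (k + i)))) \<le> exp (ln (w n (k + i)) + - t)"
        by (subst exp_le_cancel_iff) linarith
      then have "w n (Suc (k + i)) \<le> w n (k + i) * exp (- t)"
        using w_pos[of "Suc (k + i)" n] w_pos[of "k + i" n] Suc unfolding exp_add by simp
      also have "\<dots> \<le> w n k * exp (- t) ^ i * exp (- t)"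
        using Suc by (intro mult_right_mono) auto
      finally show ?case by (simp add: mult_ac)
    qed simp
    have "{j. j \<le> n \<and> Y n j \<in> {a..}} \<subseteq> (+) k ` {..n - k}"
    proof
      fix j assume j: "j \<in> {j. j \<le> n \<and> Y n j \<in> {a..}}"
      then have "real n * x + a * c n \<le> real j" using n by (simp add: Y_def field_simps)
      then have "k \<le> j" by (simp add: k_def ceiling_le_iff nat_le_iff)
      then show "j \<in> (+) k ` {..n - k}" using j by (intro image_eqI[of _ _ "j - k"]) auto
    qed
    then have "mass n {a..} \<le> sum (w n) ((+) k ` {..n - k})"
      unfolding mass_def using kn by (intro sum_mono2) (auto intro!: less_imp_le[OF w_pos])
    also have "\<dots> = (\<Sum>i\<le>n - k. w n (k + i))" by (subst sum.reindex) auto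
    also have "\<dots> \<le> (\<Sum>i\<le>n - k. w n k * exp (- t) ^ i)"
      using kn by (intro sum_mono geo) auto
    also have "\<dots> = w n k * (\<Sum>i\<le>n - k. exp (- t) ^ i)" by (simp add: sum_distrib_left)
    also have "\<dots> \<le> w n k * c n"
    proof (rule mult_left_mono)
      have lt1: "exp (- t) < 1" using t by simp
      have "(\<Sum>i\<le>n - k. exp (- t) ^ i) \<le> (\<Sum>i. exp (- t) ^ i)"
        using lt1 by (intro sum_le_suminf summable_geometric) auto
      also have "\<dots> = 1 / (1 - exp (- t))" using lt1 by (intro suminf_geometric) auto
      also have "\<dots> \<le> 1 + 1 / t"
      proof -
        have "1 + t \<le> exp t" by (rule exp_ge_add_one_self)
        then have "exp (- t) * (1 + t) \<le> 1"
          by (metis exp_ge_zero exp_minus_inverse mult.commute mult_left_mono)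
        then have "1 \<le> (1 + 1 / t) * (1 - exp (- t))" using t by (simp add: field_simps)
        then show ?thesis using lt1 by (simp add: pos_divide_le_eq)
      qed
      also have "\<dots> \<le> c n"
      proof -
        \<comment> \<open>Here the speed enters:
          \<open>1 / t = 2 * real n / (\<kappa> * a * c n)\<close> is at most
          \<open>c n / 2\<close>, and \<open>c n \<ge> 2\<close> covers the leading
          \<open>1\<close>.\<close>
        have "4 / (\<kappa> * a) \<le> c n * c n / real n" using elim by (simp add: power2_eq_square)
        then have "1 / t \<le> c n / 2" using n \<kappa> assms by (simp add: t_def field_simps)
        then show ?thesis using elim by simp
      qed
      finally show "(\<Sum>i\<le>n - k. exp (- t) ^ i) \<le> c n" .
    qed (use w_pos[of k n] kn in auto)
    also have "\<dots> \<le> (peak n * exp (- m * (\<kappa> * a\<^sup>2 / 2 - e))) * c n"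
      using wk n by (intro mult_right_mono) auto
    finally show ?case by (simp add: m_def mult_ac)
  qed
qed


text \<open>The peak is eliminated by bounding the total mass below by that of a small window at
  \<open>0\<close>. The tail estimate, the window and the factor \<open>1 / \<delta>\<close> consume
  \<open>e / 4\<close>, \<open>e / 2\<close> and \<open>e / 4\<close> of the exponent.\<close>

lemma right_tail_mass_le:
  assumes "a > 0" "e > 0"
  shows "eventually (\<lambda>n. mass n {a..} \<le>
    exp (- ((c n)\<^sup>2 / real n) * (\<kappa> * a\<^sup>2 / 2 - e)) * mass n UNIV) sequentially"
proof -
  \<comment> \<open>The radius at which the Gaussian cost
    \<open>\<kappa> * \<delta>\<^sup>2 / 2\<close> equals \<open>e / 4\<close>.\<close>
  define \<delta> where "\<delta> = sqrt (e / (2 * \<kappa>))"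
  have \<delta>: "\<delta> > 0" "\<kappa> * \<delta>\<^sup>2 / 2 = e / 4" using assms \<kappa> by (simp_all add: \<delta>_def)
  have e4: "e / 4 > 0" using assms by simp
  show ?thesis
    using right_tail_mass_le_peak[OF assms(1) e4] window_mass_ge[OF \<delta>(1) e4, of 0]
      eventually_speed_ge[of "4 / (\<delta> * e)"] eventually_ge_at_top[of 1]
  proof eventually_elim
    case (elim n)
    define m where "m = (c n)\<^sup>2 / real n"
    have half: "\<kappa> * (\<bar>0\<bar> + \<delta>)\<^sup>2 / 2 + e / 4 = e / 2" using \<delta> by simp
    then have "\<delta> * (c n * peak n * exp (- m * (e / 2))) \<le> mass n {0-\<delta>..0+\<delta>}"
      using elim(2) unfolding half by (simp add: m_def mult_ac)
    also have "\<dots> \<le> mass n UNIV" by (rule mass_mono) simp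
    finally have U: "c n * peak n * exp (- m * (e / 2)) \<le> 1 / \<delta> * mass n UNIV"
      using \<delta> by (simp add: field_simps)
    have "4 / (\<delta> * e) \<le> m" using elim(3) by (simp add: m_def)
    then have "1 / \<delta> \<le> m * (e / 4)" using assms(2) \<delta>(1) by (simp add: field_simps)
    also have "\<dots> \<le> exp (m * (e / 4))" using exp_ge_add_one_self[of "m * (e / 4)"] by linarith
    finally have \<delta>m: "1 / \<delta> \<le> exp (m * (e / 4))" .
    have "mass n {a..} \<le> c n * (peak n * exp (- m * (\<kappa> * a\<^sup>2 / 2 - e / 4)))"
      using elim(1) by (simp add: m_def)
    also have "- m * (\<kappa> * a\<^sup>2 / 2 - e / 4) = - m * (e / 2) + - m * (\<kappa> * a\<^sup>2 / 2 - 3 * e / 4)"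
      by (simp add: algebra_simps)
    also have "c n * (peak n * exp (- m * (e / 2) + - m * (\<kappa> * a\<^sup>2 / 2 - 3 * e / 4)))
        = (c n * peak n * exp (- m * (e / 2))) * exp (- m * (\<kappa> * a\<^sup>2 / 2 - 3 * e / 4))"
      unfolding exp_add by (simp add: mult_ac)
    also have "\<dots> \<le> (1 / \<delta> * mass n UNIV) * exp (- m * (\<kappa> * a\<^sup>2 / 2 - 3 * e / 4))"
      by (intro mult_right_mono U) simp
    also have "\<dots> \<le> (exp (m * (e / 4)) * mass n UNIV) * exp (- m * (\<kappa> * a\<^sup>2 / 2 - 3 * e / 4))"
      by (intro mult_right_mono \<delta>m mass_nonneg) simp
    also have "\<dots> = (exp (m * (e / 4) + - m * (\<kappa> * a\<^sup>2 / 2 - 3 * e / 4))) * mass n UNIV"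
      unfolding exp_add by (simp add: mult_ac)
    also have "m * (e / 4) + - m * (\<kappa> * a\<^sup>2 / 2 - 3 * e / 4) = - m * (\<kappa> * a\<^sup>2 / 2 - e)"
      by (simp add: algebra_simps)
    finally show ?case by (simp add: m_def)
  qed
qed

text \<open>Reflection about the centre exchanges the two tails.\<close>

lemma reflect: "log_concave_mdp c (\<lambda>n j. w n (n - j)) (1 - x) \<kappa>"
proof
  fix i j n :: nat assume "i \<le> j" "j < n"
  then have "Suc (n - Suc j) = n - j" "Suc (n - Suc i) = n - i" by simp_all
  then show "ln (w n (n - Suc j)) - ln (w n (n - j)) \<le> ln (w n (n - Suc i)) - ln (w n (n - i))"
    using log_ratio_antimono[of "n - Suc j" "n - Suc i" n] \<open>i \<le> j\<close> \<open>j < n\<close> by (simp add: diff_le_mono2)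
next
  fix R e :: real assume Re: "R \<ge> 0" "e > 0"
  have R1: "R + 1 \<ge> 0" using Re by simp
  show "eventually (\<lambda>n. \<forall>j<n. \<bar>real j - real n * (1 - x)\<bar> \<le> R * c n \<longrightarrow>
    \<bar>ln (w n (n - Suc j)) - ln (w n (n - j)) + \<kappa> * (real j - real n * (1 - x)) / real n\<bar>
      \<le> e * c n / real n) sequentially"
    using log_ratio_linearized[OF R1 half_gt_zero[OF Re(2)]] eventually_c_ge[of 1]
      eventually_c_ge[of "2 * \<kappa> / e"] eventually_ge_at_top[of 1]
  proof eventually_elim
    case (elim n)
    have n: "real n > 0" using elim by simp
    have "2 * \<kappa> \<le> e * c n" using elim(3) Re by (simp add: field_simps)
    then have k: "\<kappa> / real n \<le> e / 2 * c n / real n" using n by (simp add: field_simps)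
    show ?case
    proof (intro allI impI)
      fix j assume j: "j < n" "\<bar>real j - real n * (1 - x)\<bar> \<le> R * c n"
      \<comment> \<open>The reflected ratio at \<open>j\<close> is the reciprocal of the original
        one at \<open>i\<close>. The deviation changes sign and shifts by one, which explains the
        radius \<open>R + 1\<close> and the extra term \<open>\<kappa> / real n\<close>.\<close>
      define i where "i = n - Suc j"
      have i: "real i = real n - real j - 1" "i < n" "n - Suc j = i" "n - j = Suc i"
        using j by (auto simp: i_def of_nat_diff)
      have u: "real j - real n * (1 - x) = - (real i - real n * x) - 1"
        using i by (simp add: algebra_simps)
      have "\<bar>real i - real n * x\<bar> \<le> (R + 1) * c n"
        using j(2) elim(2) unfolding u distrib_right by linarith
      then have "\<bar>ln (w n (Suc i)) - ln (w n i) + \<kappa> * (real i - real n * x) / real n\<bar>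
          \<le> e / 2 * c n / real n"
        using elim(1) i(2) by blast
      moreover have "\<kappa> * (real j - real n * (1 - x)) / real n
          = - (\<kappa> * (real i - real n * x) / real n) - \<kappa> / real n"
        unfolding u by (simp add: algebra_simps diff_divide_distrib add_divide_distrib)
      moreover have "\<kappa> / real n \<ge> 0" using \<kappa> by simp
      moreover have "\<bar>b - a + d\<bar> \<le> q" if "\<bar>a - b + t\<bar> \<le> h" "d = - t - k" "k \<ge> 0" "k \<le> h" "q = h + h"
        for a b d t h k q :: real using that by linarith
      moreover have "e * c n / real n = e / 2 * c n / real n + e / 2 * c n / real n" by simp
      ultimately show "\<bar>ln (w n (n - Suc j)) - ln (w n (n - j)) + \<kappa> * (real j - real n * (1 - x)) / real n\<bar>
          \<le> e * c n / real n"
        unfolding i(3,4) using k by blast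
    qed
  qed
qed (use x \<kappa> w_pos in auto)

lemma left_tail_mass_le:
  assumes "a > 0" "e > 0"
  shows "eventually (\<lambda>n. mass n {..-a} \<le>
    exp (- ((c n)\<^sup>2 / real n) * (\<kappa> * a\<^sup>2 / 2 - e)) * mass n UNIV) sequentially"
proof -
  interpret R: log_concave_mdp c "\<lambda>n j. w n (n - j)" "1 - x" \<kappa> by (rule reflect)
  \<comment> \<open>The substitution \<open>j \<mapsto> n - j\<close> negates deviations, so the
    left tail is a right tail of the reflected weights.\<close>
  have mass: "R.mass n (uminus -` B) = mass n B" for n B
  proof -
    have Y: "R.Y n (n - j) = - Y n j" if "j \<le> n" for j
      using that by (simp add: R.Y_def Y_def of_nat_diff algebra_simps minus_divide_left)
    have Y': "- R.Y n j = Y n (n - j)" if "j \<le> n" for j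
      using Y[of "n - j"] that by simp
    show ?thesis unfolding R.mass_def mass_def
      by (rule sum.reindex_bij_witness[of _ "\<lambda>j. n - j" "\<lambda>j. n - j"]) (auto simp: Y Y')
  qed
  have "uminus -` {..-a} = {a..}" by auto
  with R.right_tail_mass_le[OF assms] mass[of _ "{..-a}"] mass[of _ UNIV] show ?thesis by simp
qed

text \<open>The factor two from adding the tails is absorbed by the second half of
  \<open>e\<close>.\<close>

lemma tails_mass_le:
  assumes "a > 0" "e > 0"
  shows "eventually (\<lambda>n. mass n {z. a \<le> \<bar>z\<bar>} \<le>
    exp (- ((c n)\<^sup>2 / real n) * (\<kappa> * a\<^sup>2 / 2 - e)) * mass n UNIV) sequentially"
  using left_tail_mass_le[OF assms(1) half_gt_zero[OF assms(2)]]
    right_tail_mass_le[OF assms(1) half_gt_zero[OF assms(2)]] eventually_speed_ge[of "4 / e"]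
proof eventually_elim
  case (elim n)
  define m where "m = (c n)\<^sup>2 / real n"
  have "4 / e \<le> m" using elim(3) by (simp add: m_def)
  then have "2 \<le> m * (e / 2)" using assms by (simp add: field_simps)
  then have 2: "2 \<le> exp (m * (e / 2))" using exp_ge_add_one_self[of "m * (e / 2)"] by linarith
  have "{z. a \<le> \<bar>z\<bar>} = {..-a} \<union> {a..}" by auto
  then have "mass n {z. a \<le> \<bar>z\<bar>} \<le> mass n {..-a} + mass n {a..}" using mass_Un_le by simp
  also have "\<dots> \<le> 2 * (exp (- m * (\<kappa> * a\<^sup>2 / 2 - e / 2)) * mass n UNIV)"
    using elim unfolding m_def by linarith
  also have "\<dots> \<le> exp (m * (e / 2)) * (exp (- m * (\<kappa> * a\<^sup>2 / 2 - e / 2)) * mass n UNIV)"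
    using 2 by (intro mult_right_mono mult_nonneg_nonneg mass_nonneg) auto
  also have "\<dots> = exp (m * (e / 2) + - m * (\<kappa> * a\<^sup>2 / 2 - e / 2)) * mass n UNIV"
    unfolding exp_add by simp
  also have "m * (e / 2) + - m * (\<kappa> * a\<^sup>2 / 2 - e / 2) = - m * (\<kappa> * a\<^sup>2 / 2 - e)"
    by (simp add: algebra_simps)
  finally show ?case by (simp add: m_def)
qed

section \<open>Comparing windows with the total mass\<close>

text \<open>The tails beyond \<open>1\<close> eventually carry at most half of the total mass, so
  the total is at most twice the central mass.\<close>

lemma mass_UNIV_le_peak:
  assumes "e > 0"
  shows "eventually (\<lambda>n. mass n UNIV \<le> 6 * c n * (peak n * exp ((c n)\<^sup>2 / real n * e))) sequentially"
proof -
  have k4: "\<kappa> / 4 > 0" using \<kappa> by simp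
  show ?thesis
    using tails_mass_le[OF zero_less_one k4] central_mass_le[OF assms] eventually_speed_ge[of "4 / \<kappa>"]
  proof eventually_elim
    case (elim n)
    define m where "m = (c n)\<^sup>2 / real n"
    have "1 \<le> m * (\<kappa> / 4)" using elim(3) \<kappa> by (simp add: m_def field_simps)
    then have "2 \<le> exp (m * (\<kappa> / 4))" using exp_ge_add_one_self[of "m * (\<kappa> / 4)"] by linarith
    then have "exp (- (m * (\<kappa> / 4))) \<le> 1 / 2" by (simp add: exp_minus field_simps)
    moreover have "- m * (\<kappa> * 1\<^sup>2 / 2 - \<kappa> / 4) = - (m * (\<kappa> / 4))" by (simp add: algebra_simps)
    ultimately have "exp (- m * (\<kappa> * 1\<^sup>2 / 2 - \<kappa> / 4)) * mass n UNIV \<le> 1 / 2 * mass n UNIV"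
      by (intro mult_right_mono mass_nonneg) simp
    then have "mass n {z. 1 \<le> \<bar>z\<bar>} \<le> 1 / 2 * mass n UNIV"
      using elim(1) unfolding m_def by linarith
    moreover have "mass n UNIV \<le> mass n {-1..1} + mass n {z. 1 \<le> \<bar>z\<bar>}"
    proof -
      have "(UNIV :: real set) = {-1..1} \<union> {z. 1 \<le> \<bar>z\<bar>}" by auto
      then show ?thesis using mass_Un_le by metis
    qed
    ultimately show ?case using elim(2) by linarith
  qed
qed

text \<open>Works in a smaller window of radius \<open>r\<close>. The allowance \<open>e\<close> is
  spent in quarters: on the upper bound for the total, on the constant \<open>6 / r\<close>, on the
  weights in the window, and on replacing \<open>\<bar>z\<bar> + r\<close> by
  \<open>\<bar>z\<bar>\<close>.\<close>

lemma window_mass_ge_total: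
  assumes "\<rho> > 0" "e > 0"
  shows "eventually (\<lambda>n. mass n {z-\<rho>..z+\<rho>} \<ge>
    exp (- ((c n)\<^sup>2 / real n) * (\<kappa> * z\<^sup>2 / 2 + e)) * mass n UNIV) sequentially"
proof -
  \<comment> \<open>The bound \<open>r \<le> 1\<close> gives \<open>r * r \<le> r\<close>, so the
    last entry controls both terms \<open>\<kappa> * \<bar>z\<bar> * r\<close> and
    \<open>\<kappa> * (r * r) / 2\<close> of the expanded square.\<close>
  define r where "r = Min {\<rho>, 1, e / (4 * \<kappa> * (2 * \<bar>z\<bar> + 1))}"
  have r: "r > 0" "r \<le> \<rho>" "r \<le> 1" "r \<le> e / (4 * \<kappa> * (2 * \<bar>z\<bar> + 1))"
    using assms \<kappa> by (auto simp: r_def)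
  have "r * (4 * \<kappa> * (2 * \<bar>z\<bar> + 1)) \<le> e"
    using r(4) \<kappa> by (subst (asm) pos_le_divide_eq) auto
  moreover have "\<kappa> * (r * r) \<le> \<kappa> * (r * 1)"
    using r \<kappa> by (intro mult_left_mono) auto
  moreover have "\<kappa> * (\<bar>z\<bar> + r)\<^sup>2 / 2 = \<kappa> * z\<^sup>2 / 2 + \<kappa> * \<bar>z\<bar> * r + \<kappa> * (r * r) / 2"
    by (simp add: power2_sum algebra_simps add_divide_distrib power2_eq_square)
  moreover have "\<kappa> * \<bar>z\<bar> * r \<ge> 0" "\<kappa> * r \<ge> 0" using r \<kappa> by auto
  ultimately have zr: "\<kappa> * (\<bar>z\<bar> + r)\<^sup>2 / 2 \<le> \<kappa> * z\<^sup>2 / 2 + e / 4"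
    by (simp add: algebra_simps)
  have e4: "e / 4 > 0" using assms by simp
  show ?thesis
    using window_mass_ge[OF r(1) e4, of z] mass_UNIV_le_peak[OF e4]
      eventually_speed_ge[of "24 / (r * e)"] eventually_ge_at_top[of 1]
  proof eventually_elim
    case (elim n)
    define m where "m = (c n)\<^sup>2 / real n"
    have m: "m \<ge> 0" by (simp add: m_def)
    have cn: "c n > 0" using elim c_pos by simp
    have "24 / (r * e) \<le> m" using elim(3) by (simp add: m_def)
    then have "6 / r \<le> m * (e / 4)" using r(1) assms by (simp add: field_simps)
    then have "6 / r \<le> exp (m * (e / 4))" using exp_ge_add_one_self[of "m * (e / 4)"] by linarith
    then have 6: "6 \<le> r * exp (m * (e / 4))" using r by (simp add: field_simps)
    have "exp (- m * (\<kappa> * z\<^sup>2 / 2 + e)) * mass n UNIV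
        \<le> exp (- m * (\<kappa> * z\<^sup>2 / 2 + e)) * (6 * c n * (peak n * exp (m * (e / 4))))"
      using elim(2) by (intro mult_left_mono) (auto simp: m_def)
    also have "\<dots> = 6 * (c n * peak n * exp (m * (e / 4)) * exp (- m * (\<kappa> * z\<^sup>2 / 2 + e)))"
      by (simp add: mult_ac)
    also have "\<dots> \<le> (r * exp (m * (e / 4))) * (c n * peak n * exp (m * (e / 4)) * exp (- m * (\<kappa> * z\<^sup>2 / 2 + e)))"
      using 6 cn peak_pos[of n] by (intro mult_right_mono) auto
    also have "\<dots> = r * c n * (peak n * exp (m * (e / 4) + m * (e / 4) + - m * (\<kappa> * z\<^sup>2 / 2 + e)))"
      unfolding exp_add by (simp add: mult_ac)
    also have "m * (e / 4) + m * (e / 4) + - m * (\<kappa> * z\<^sup>2 / 2 + e) = - m * ((\<kappa> * z\<^sup>2 / 2 + e / 4) + e / 4)"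
      by (simp add: algebra_simps)
    also have "r * c n * (peak n * exp (- m * ((\<kappa> * z\<^sup>2 / 2 + e / 4) + e / 4)))
        \<le> r * c n * (peak n * exp (- m * (\<kappa> * (\<bar>z\<bar> + r)\<^sup>2 / 2 + e / 4)))"
    proof -
      have "m * (\<kappa> * (\<bar>z\<bar> + r)\<^sup>2 / 2 + e / 4) \<le> m * ((\<kappa> * z\<^sup>2 / 2 + e / 4) + e / 4)"
        using m zr by (intro mult_left_mono) auto
      then show ?thesis using r cn peak_pos[of n] by (intro mult_left_mono) auto
    qed
    also have "\<dots> \<le> mass n {z-r..z+r}" using elim(1) by (simp add: m_def)
    also have "\<dots> \<le> mass n {z-\<rho>..z+\<rho>}" using r by (intro mass_mono) auto
    finally show ?case by (simp add: m_def)
  qed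
qed

end

section \<open>Upper and lower bounds on the logarithmic scale\<close>

lemma scaled_log_prob_le:
  assumes "n > 0" "0 < c" "0 \<le> p" "p \<le> exp (- (c\<^sup>2 / n) * b)"
  shows "ereal (n / c\<^sup>2) * log_prob p \<le> ereal (- b)"
proof (cases "p = 0")
  \<comment> \<open>Here \<open>log_prob p\<close> is \<open>- \<infinity>\<close>, and positivity
    of \<open>n\<close> and \<open>c\<close> excludes the product of zero and infinity, which would
    be \<open>0\<close>.\<close>
  case True
  then show ?thesis using assms by (simp add: log_prob_def)
next
  case False
  then have "ln p \<le> - (c\<^sup>2 / n) * b"
    using assms by (metis exp_le_cancel_iff exp_ln order_less_le)
  then have "(n / c\<^sup>2) * ln p \<le> (n / c\<^sup>2) * (- (c\<^sup>2 / n) * b)"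
    using assms by (intro mult_left_mono) auto
  then show ?thesis using False assms by (simp add: log_prob_def)
qed

lemma scaled_log_prob_ge:
  assumes "n > 0" "0 < c" "p \<ge> exp (- (c\<^sup>2 / n) * b)"
  shows "ereal (n / c\<^sup>2) * log_prob p \<ge> ereal (- b)"
proof -
  have p: "p > 0" using assms(3) exp_gt_zero less_le_trans by blast
  then have "- (c\<^sup>2 / n) * b \<le> ln p"
    using assms by (metis exp_le_cancel_iff exp_ln)
  then have "(n / c\<^sup>2) * (- (c\<^sup>2 / n) * b) \<le> (n / c\<^sup>2) * ln p"
    using assms by (intro mult_left_mono) auto
  then show ?thesis using p assms by (simp add: log_prob_def)
qed

context log_concave_mdp
begin

text \<open>A nonempty closed set has a point \<open>z\<close> of least absolute value. It minimises
  the rate, and the whole set lies in the two-sided tail beyond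
  \<open>\<bar>z\<bar>\<close>.\<close>

lemma limsup_closed_le:
  fixes F :: "real set"
  assumes "closed F"
  shows "limsup (\<lambda>n. ereal (real n / (c n)\<^sup>2) * log_prob (mass n F / mass n UNIV))
    \<le> - (INF z\<in>F. ereal (\<kappa> * z\<^sup>2 / 2))"
proof (cases "F = {}")
  case True
  \<comment> \<open>For the empty set both sides are \<open>- \<infinity>\<close>. The index
    \<open>0\<close> has to be avoided, since there the factor vanishes and the product is
    \<open>0\<close>.\<close>
  have "eventually (\<lambda>n. ereal (real n / (c n)\<^sup>2) * log_prob (mass n F / mass n UNIV) \<le> -\<infinity>) sequentially"
    using eventually_ge_at_top[of 1]
    by eventually_elim (use True c_pos in \<open>force simp: mass_def log_prob_def\<close>)
  then have "limsup (\<lambda>n. ereal (real n / (c n)\<^sup>2) * log_prob (mass n F / mass n UNIV)) \<le> -\<infinity>"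
    by (rule Limsup_bounded)
  then show ?thesis using True by (simp add: top_ereal_def)
next
  case False
  obtain z where z: "z \<in> F" "\<And>y. y \<in> F \<Longrightarrow> dist 0 z \<le> dist 0 y"
    using distance_attains_inf[OF assms False, of 0] by blast
  have F: "F \<subseteq> {y. \<bar>z\<bar> \<le> \<bar>y\<bar>}" using z by (auto simp: dist_norm)
  have "limsup (\<lambda>n. ereal (real n / (c n)\<^sup>2) * log_prob (mass n F / mass n UNIV))
    \<le> ereal (- (\<kappa> * z\<^sup>2 / 2))"
  proof (rule ereal_le_epsilon2)
    fix e :: real assume e: "e > 0"
    have bnd: "eventually (\<lambda>n. mass n F \<le>
      exp (- ((c n)\<^sup>2 / real n) * (\<kappa> * z\<^sup>2 / 2 - e)) * mass n UNIV) sequentially"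
    proof (cases "z = 0")
      \<comment> \<open>The tail estimate requires a positive radius; at \<open>z = 0\<close> the
        trivial bound by the total mass suffices.\<close>
      case True
      have "mass n F \<le> exp (- ((c n)\<^sup>2 / real n) * (\<kappa> * z\<^sup>2 / 2 - e)) * mass n UNIV" for n
      proof -
        have "mass n F \<le> 1 * mass n UNIV" using mass_mono[of F UNIV n] by simp
        also have "\<dots> \<le> exp (- ((c n)\<^sup>2 / real n) * (\<kappa> * z\<^sup>2 / 2 - e)) * mass n UNIV"
          using True e by (intro mult_right_mono mass_nonneg) simp
        finally show ?thesis .
      qed
      then show ?thesis by simp
    next
      case False
      then have "\<bar>z\<bar> > 0" by simp
      from tails_mass_le[OF this e] show ?thesis
        by eventually_elim (use mass_mono[OF F] in \<open>auto intro: order_trans\<close>)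
    qed
    have "eventually (\<lambda>n. ereal (real n / (c n)\<^sup>2) * log_prob (mass n F / mass n UNIV)
      \<le> ereal (- (\<kappa> * z\<^sup>2 / 2 - e))) sequentially"
      using bnd eventually_ge_at_top[of 1]
      by eventually_elim
        (intro scaled_log_prob_le, use c_pos mass_nonneg mass_UNIV_pos in \<open>auto simp: pos_divide_le_eq\<close>)
    then have "limsup (\<lambda>n. ereal (real n / (c n)\<^sup>2) * log_prob (mass n F / mass n UNIV))
      \<le> ereal (- (\<kappa> * z\<^sup>2 / 2 - e))" by (rule Limsup_bounded)
    then show "limsup (\<lambda>n. ereal (real n / (c n)\<^sup>2) * log_prob (mass n F / mass n UNIV))
      \<le> ereal (- (\<kappa> * z\<^sup>2 / 2)) + ereal e" by simp
  qed
  also have "\<dots> = - ereal (\<kappa> * z\<^sup>2 / 2)" by simp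
  also have "\<dots> \<le> - (INF z\<in>F. ereal (\<kappa> * z\<^sup>2 / 2))"
    unfolding ereal_minus_le_minus using z(1) by (rule INF_lower)
  finally show ?thesis .
qed

text \<open>Every point of an open set has a window around it inside the set. Arguing point by point
  needs no minimiser, and the empty set is covered as well.\<close>

lemma liminf_open_ge:
  fixes G :: "real set"
  assumes "open G"
  shows "liminf (\<lambda>n. ereal (real n / (c n)\<^sup>2) * log_prob (mass n G / mass n UNIV))
    \<ge> - (INF z\<in>G. ereal (\<kappa> * z\<^sup>2 / 2))" (is "?L \<ge> _")
proof -
  have "ereal (- (\<kappa> * z\<^sup>2 / 2)) \<le> ?L" if z: "z \<in> G" for z
  proof (rule ereal_le_epsilon2)
    fix e :: real assume e: "e > 0"
    obtain \<rho> where \<rho>: "\<rho> > 0" "cball z \<rho> \<subseteq> G"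
      using assms z open_contains_cball by blast
    have G: "{z-\<rho>..z+\<rho>} \<subseteq> G" using \<rho>(2) by (simp add: cball_eq_atLeastAtMost)
    have "eventually (\<lambda>n. ereal (real n / (c n)\<^sup>2) * log_prob (mass n G / mass n UNIV)
      \<ge> ereal (- (\<kappa> * z\<^sup>2 / 2 + e))) sequentially"
      using window_mass_ge_total[OF \<rho>(1) e, of z] eventually_ge_at_top[of 1]
    proof eventually_elim
      case (elim n)
      then have "exp (- ((c n)\<^sup>2 / real n) * (\<kappa> * z\<^sup>2 / 2 + e)) * mass n UNIV \<le> mass n G"
        using mass_mono[OF G, of n] by linarith
      then show ?case
        using elim c_pos mass_UNIV_pos[of n] by (intro scaled_log_prob_ge) (auto simp: pos_le_divide_eq)
    qed
    then have "ereal (- (\<kappa> * z\<^sup>2 / 2 + e)) \<le> ?L" by (rule Liminf_bounded)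
    then have "ereal (- (\<kappa> * z\<^sup>2 / 2 + e)) + ereal e \<le> ?L + ereal e" by (rule add_right_mono)
    then show "ereal (- (\<kappa> * z\<^sup>2 / 2)) \<le> ?L + ereal e" by simp
  qed
  then have "- ereal (\<kappa> * z\<^sup>2 / 2) \<le> ?L" if "z \<in> G" for z
    using that by simp
  then have "- ?L \<le> (INF z\<in>G. ereal (\<kappa> * z\<^sup>2 / 2))"
    by (rule INF_greatest[OF iffD1[OF ereal_uminus_le_reorder]])
  then show ?thesis by (rule iffD1[OF ereal_uminus_le_reorder])
qed

end

section \<open>The fractional binomial weights as an instance\<close>

lemma ln_frac_binomial_weight:
  assumes "\<alpha> > 0" "0 < x" "x < 1" "j \<le> n"
  shows "frac_binomial_weight \<alpha> n x j > 0"
    and "ln (frac_binomial_weight \<alpha> n x j) =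
      ln (Gamma (\<alpha> * real n + 1)) - ln (Gamma (\<alpha> * real j + 1)) - ln (Gamma (\<alpha> * real (n - j) + 1))
      + \<alpha> * real j * ln x + \<alpha> * real (n - j) * ln (1 - x)"
proof -
  have eq: "frac_binomial_weight \<alpha> n x j =
      Gamma (\<alpha> * real n + 1) / (Gamma (\<alpha> * real j + 1) * Gamma (\<alpha> * real (n - j) + 1))
      * x powr (\<alpha> * real j) * (1 - x) powr (\<alpha> * real (n - j))"
    using assms
    by (simp add: frac_binomial_weight_def real_binomial_def rpow_def of_nat_diff algebra_simps)
  have G: "Gamma (\<alpha> * real k + 1) > 0" for k
    using assms by (intro Gamma_real_pos add_nonneg_pos) auto
  show "frac_binomial_weight \<alpha> n x j > 0" unfolding eq using G[of n] G[of j] G[of "n - j"] assms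
    by (intro mult_pos_pos divide_pos_pos) auto
  show "ln (frac_binomial_weight \<alpha> n x j) =
      ln (Gamma (\<alpha> * real n + 1)) - ln (Gamma (\<alpha> * real j + 1)) - ln (Gamma (\<alpha> * real (n - j) + 1))
      + \<alpha> * real j * ln x + \<alpha> * real (n - j) * ln (1 - x)"
    unfolding eq using G[of n] G[of j] G[of "n - j"] assms
    by (simp add: ln_mult ln_div ln_powr)
qed

text \<open>The numerator cancels, and the two Gamma arguments in the denominator move by
  \<open>\<alpha>\<close> in opposite directions.\<close>

lemma ln_frac_binomial_weight_ratio:
  assumes "\<alpha> > 0" "0 < x" "x < 1" "j < n"
  shows "ln (frac_binomial_weight \<alpha> n x (Suc j)) - ln (frac_binomial_weight \<alpha> n x j) =
    lnGamma_diff \<alpha> (\<alpha> * real (n - Suc j) + 1) - lnGamma_diff \<alpha> (\<alpha> * real j + 1)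
    + \<alpha> * (ln x - ln (1 - x))"
proof -
  have "real (n - j) = real (n - Suc j) + 1" using assms by (simp add: of_nat_diff)
  then show ?thesis
    using assms by (simp add: ln_frac_binomial_weight lnGamma_diff_def algebra_simps)
qed

text \<open>Collects three errors of size \<open>q\<close>: the linearisations of the increments at
  the reflected index and at \<open>j\<close>, and the off-by-one term \<open>k\<close>.\<close>

lemma abs_combine_le:
  fixes q :: real
  assumes "\<bar>a - s - w\<bar> \<le> q" "\<bar>b - t - v\<bar> \<le> q" "0 \<le> k" "k \<le> q"
  shows "\<bar>a - b + (t - s) + (v - w - k)\<bar> \<le> 3 * q"
  using assms by linarith

text \<open>Rests on \<open>1 / (x * (1 - x)) = 1 / x + 1 / (1 - x)\<close>. The numerator
  \<open>- u - 1\<close> is the deviation of the reflected index \<open>n - Suc j\<close>, and the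
  last term compensates its \<open>- 1\<close>.\<close>

lemma rate_partial_fractions:
  fixes x :: real
  assumes "0 < x" "x < 1" "N > 0"
  shows "\<alpha> / (x * (1 - x)) * u / N =
    \<alpha> * u / (N * x) - \<alpha> * (- u - 1) / (N * (1 - x)) - \<alpha> / (N * (1 - x))"
proof -
  have 1: "\<alpha> / (x * (1 - x)) * u = \<alpha> * u / x + \<alpha> * u / (1 - x)"
    using assms by (simp add: field_simps)
  have 2: "- \<alpha> * (- u - 1) / (N * (1 - x)) = \<alpha> * u / (N * (1 - x)) + \<alpha> / (N * (1 - x))"
    by (simp add: add_divide_distrib[symmetric] algebra_simps)
  show ?thesis unfolding 1 using 2 by (simp add: add_divide_distrib mult.commute)
qed

text \<open>Monotone Gamma increments, taken at \<open>j\<close> and at \<open>n - Suc j\<close>,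
  yield concavity. Their linearisations around \<open>x\<close> and \<open>1 - x\<close> have slopes
  \<open>\<alpha> / x\<close> and \<open>\<alpha> / (1 - x)\<close>, which add up to the claimed
  \<open>\<kappa>\<close>.\<close>

lemma log_concave_mdp_frac_binomial_weight:
  assumes "\<alpha> > 0" "0 < x" "x < 1" "moderate_scale c"
  shows "log_concave_mdp c (\<lambda>n. frac_binomial_weight \<alpha> n x) x (\<alpha> / (x * (1 - x)))"
proof -
  interpret moderate_scale c by fact
  show ?thesis
  proof
    fix i j n :: nat assume ij: "i \<le> j" "j < n"
    have "lnGamma_diff \<alpha> (\<alpha> * real i + 1) \<le> lnGamma_diff \<alpha> (\<alpha> * real j + 1)"
      using assms ij by (intro lnGamma_diff_mono add_nonneg_pos) auto
    moreover have "lnGamma_diff \<alpha> (\<alpha> * real (n - Suc j) + 1) \<le> lnGamma_diff \<alpha> (\<alpha> * real (n - Suc i) + 1)"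
      using assms ij by (intro lnGamma_diff_mono add_nonneg_pos) auto
    ultimately show "ln (frac_binomial_weight \<alpha> n x (Suc j)) - ln (frac_binomial_weight \<alpha> n x j)
        \<le> ln (frac_binomial_weight \<alpha> n x (Suc i)) - ln (frac_binomial_weight \<alpha> n x i)"
      unfolding ln_frac_binomial_weight_ratio[OF assms(1-3) ij(2)]
        ln_frac_binomial_weight_ratio[OF assms(1-3) le_less_trans[OF ij]] by linarith
  next
    fix R e :: real assume Re: "R \<ge> 0" "e > 0"
    have R1: "R + 1 \<ge> 0" and e3: "e / 3 > 0" and y: "1 - x > 0" using Re assms by auto
    show "eventually (\<lambda>n. \<forall>j<n. \<bar>real j - real n * x\<bar> \<le> R * c n \<longrightarrow>
      \<bar>ln (frac_binomial_weight \<alpha> n x (Suc j)) - ln (frac_binomial_weight \<alpha> n x j)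
        + \<alpha> / (x * (1 - x)) * (real j - real n * x) / real n\<bar> \<le> e * c n / real n) sequentially"
      using lnGamma_diff_linearized[OF assms(1,2) Re(1) e3] lnGamma_diff_linearized[OF assms(1) y R1 e3]
        eventually_c_ge[of 1] eventually_c_ge[of "3 * \<alpha> / (e * (1 - x))"] eventually_ge_at_top[of 1]
    proof eventually_elim
      case (elim n)
      have n: "real n > 0" using elim by simp
      define q where "q = e / 3 * c n / real n"
      have q3: "e * c n / real n = 3 * q" by (simp add: q_def)
      have "3 * \<alpha> \<le> c n * (e * (1 - x))"
        using elim(4) Re y by (subst (asm) pos_divide_le_eq) auto
      then have "\<alpha> / (1 - x) \<le> e / 3 * c n" using y by (simp add: field_simps)
      then have "\<alpha> / (1 - x) / real n \<le> q" unfolding q_def using n by (intro divide_right_mono) auto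
      then have k: "\<alpha> / (real n * (1 - x)) \<le> q" by (simp add: mult.commute)
      have k0: "0 \<le> \<alpha> / (real n * (1 - x))" using assms y by simp
      show ?case
      proof (intro allI impI)
        fix j assume j: "j < n" "\<bar>real j - real n * x\<bar> \<le> R * c n"
        define i where "i = n - Suc j"
        define u where "u = real j - real n * x"
        have i: "real i - real n * (1 - x) = - u - 1"
          using j by (simp add: i_def u_def of_nat_diff algebra_simps)
        have "\<bar>real i - real n * (1 - x)\<bar> \<le> (R + 1) * c n"
          using j(2) elim(3) unfolding i distrib_right u_def by linarith
        from elim(2)[rule_format, OF this] have 1: "\<bar>lnGamma_diff \<alpha> (\<alpha> * real i + 1) - \<alpha> * ln (\<alpha> * real n * (1 - x))
            - \<alpha> * (- u - 1) / (real n * (1 - x))\<bar> \<le> q"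
          unfolding q_def i by simp
        have 2: "\<bar>lnGamma_diff \<alpha> (\<alpha> * real j + 1) - \<alpha> * ln (\<alpha> * real n * x) - \<alpha> * u / (real n * x)\<bar> \<le> q"
          using elim(1) j(2) unfolding q_def u_def by blast
        \<comment> \<open>The powers of \<open>x\<close> and \<open>1 - x\<close> in the weights
          cancel exactly the constant terms of the two linearisations.\<close>
        have 3: "\<alpha> * (ln x - ln (1 - x)) = \<alpha> * ln (\<alpha> * real n * x) - \<alpha> * ln (\<alpha> * real n * (1 - x))"
          using assms n by (simp add: ln_mult) (simp add: algebra_simps)
        have 4: "\<alpha> / (x * (1 - x)) * u / real n =
            \<alpha> * u / (real n * x) - \<alpha> * (- u - 1) / (real n * (1 - x)) - \<alpha> / (real n * (1 - x))"
          using assms n by (intro rate_partial_fractions) auto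
        show "\<bar>ln (frac_binomial_weight \<alpha> n x (Suc j)) - ln (frac_binomial_weight \<alpha> n x j)
            + \<alpha> / (x * (1 - x)) * (real j - real n * x) / real n\<bar> \<le> e * c n / real n"
          unfolding ln_frac_binomial_weight_ratio[OF assms(1-3) j(1)] 3 u_def[symmetric] 4 q3
            i_def[symmetric]
          by (rule abs_combine_le[OF 1 2 k0 k])
      qed
    qed
  next
    show "0 < x" "x < 1" by fact+
    show "0 < \<alpha> / (x * (1 - x))" using assms(1-3) by simp
    show "0 < frac_binomial_weight \<alpha> n x j" if "j \<le> n" for n j
      using assms(1-3) that by (rule ln_frac_binomial_weight(1))
  qed
qed

section \<open>Transfer to the random variables\<close>

lemma measure_frac_binomial:
  assumes "\<alpha> > 0" "0 < x" "x < 1"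
  shows "measure (frac_binomial \<alpha> n x) {j. j \<le> n \<and> P j} =
    (\<Sum>j | j \<le> n \<and> P j. frac_binomial_weight \<alpha> n x j) / (\<Sum>j\<le>n. frac_binomial_weight \<alpha> n x j)"
proof -
  have Z: "frac_binomial_Z \<alpha> n x > 0" using assms by (intro frac_binomial_Z_pos) auto
  let ?p = "\<lambda>j. \<alpha> / frac_binomial_Z \<alpha> n x * frac_binomial_weight \<alpha> n x j"
  have p: "?p j \<ge> 0" if "j \<le> n" for j
    using that Z assms by (intro mult_nonneg_nonneg frac_binomial_weight_nonneg) auto
  have "emeasure (frac_binomial \<alpha> n x) {j. j \<le> n \<and> P j} = (\<Sum>j | j \<le> n \<and> P j. ennreal (?p j))"
    unfolding frac_binomial_def by (rule emeasure_point_measure_finite) auto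
  also have "\<dots> = ennreal (\<Sum>j | j \<le> n \<and> P j. ?p j)" using p by (intro sum_ennreal) auto
  finally have "measure (frac_binomial \<alpha> n x) {j. j \<le> n \<and> P j} = (\<Sum>j | j \<le> n \<and> P j. ?p j)"
    unfolding measure_def by (simp only:) (rule enn2real_ennreal, use p in \<open>auto intro!: sum_nonneg\<close>)
  also have "\<dots> = \<alpha> / frac_binomial_Z \<alpha> n x * (\<Sum>j | j \<le> n \<and> P j. frac_binomial_weight \<alpha> n x j)"
    by (simp add: sum_distrib_left)
  also have "\<alpha> / frac_binomial_Z \<alpha> n x = 1 / (\<Sum>j\<le>n. frac_binomial_weight \<alpha> n x j)"
    using assms by (simp add: frac_binomial_Z_def atMost_atLeast0)
  finally show ?thesis by simp
qed

theorem theorem2p5: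
  fixes \<alpha> x :: real
    and M :: "nat \<Rightarrow> 'a measure"
    and S :: "nat \<Rightarrow> 'a \<Rightarrow> real"
    and c :: "nat \<Rightarrow> real"
  assumes "\<alpha> > 0"
    and "0 < x" and "x < 1"
    and "\<And>n. n \<ge> 1 \<Longrightarrow> prob_space (M n)"
    and "\<And>n. n \<ge> 1 \<Longrightarrow> S n \<in> borel_measurable (M n)"
    and "\<And>n. n \<ge> 1 \<Longrightarrow> distr (M n) borel (S n) = distr (frac_binomial \<alpha> n x) borel real"
    and "\<And>n. n \<ge> 1 \<Longrightarrow> c n > 0"
    and "(\<lambda>n. c n / real n) \<longlonglongrightarrow> 0"
    and "filterlim (\<lambda>n. c n / sqrt (real n)) at_top sequentially"
  shows "(\<forall>F::real set. closed F \<longrightarrow>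
            limsup (\<lambda>n. ereal (real n / (c n)\<^sup>2) *
              log_prob (measure (M n) {\<omega> \<in> space (M n). (S n \<omega> - real n * x) / c n \<in> F}))
            \<le> - (INF z\<in>F. ereal (mdp_rate \<alpha> x z)))
       \<and> (\<forall>G::real set. open G \<longrightarrow>
            liminf (\<lambda>n. ereal (real n / (c n)\<^sup>2) *
              log_prob (measure (M n) {\<omega> \<in> space (M n). (S n \<omega> - real n * x) / c n \<in> G}))
            \<ge> - (INF z\<in>G. ereal (mdp_rate \<alpha> x z)))"
proof -
  define \<kappa> where "\<kappa> = \<alpha> / (x * (1 - x))"
  have scale: "moderate_scale c" using assms(7-9) by (rule moderate_scale.intro)
  interpret log_concave_mdp c "\<lambda>n. frac_binomial_weight \<alpha> n x" x \<kappa>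
    unfolding \<kappa>_def by (rule log_concave_mdp_frac_binomial_weight[OF assms(1-3) scale])
  have rate: "mdp_rate \<alpha> x z = \<kappa> * z\<^sup>2 / 2" for z
    by (simp add: mdp_rate_def \<kappa>_def)
  \<comment> \<open>Only the law of \<open>S n\<close> matters: the event is a preimage under
    \<open>S n\<close>, so its probability is a ratio of masses of raw weights.\<close>
  have prob: "measure (M n) {\<omega> \<in> space (M n). (S n \<omega> - real n * x) / c n \<in> B} = mass n B / mass n UNIV"
    if n: "n \<ge> 1" and [measurable]: "B \<in> sets borel" for n B
  proof -
    define A where "A = {s. (s - real n * x) / c n \<in> B}"
    have A: "A \<in> sets borel" unfolding A_def by measurable
    have real: "real \<in> measurable (frac_binomial \<alpha> n x) borel"
      by (simp add: frac_binomial_def measurable_def space_point_measure sets_point_measure)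
    have "{\<omega> \<in> space (M n). (S n \<omega> - real n * x) / c n \<in> B} = S n -` A \<inter> space (M n)"
      by (auto simp: A_def)
    then have "measure (M n) {\<omega> \<in> space (M n). (S n \<omega> - real n * x) / c n \<in> B}
        = measure (distr (M n) borel (S n)) A"
      by (simp only: measure_distr[OF assms(5)[OF n] A])
    also have "\<dots> = measure (frac_binomial \<alpha> n x) (real -` A \<inter> space (frac_binomial \<alpha> n x))"
      unfolding assms(6)[OF n] by (rule measure_distr[OF real A])
    also have "real -` A \<inter> space (frac_binomial \<alpha> n x) = {j. j \<le> n \<and> Y n j \<in> B}"
      by (auto simp: A_def Y_def frac_binomial_def space_point_measure)
    also have "measure (frac_binomial \<alpha> n x) {j. j \<le> n \<and> Y n j \<in> B} = mass n B / mass n UNIV"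
      unfolding measure_frac_binomial[OF assms(1-3)] mass_def atMost_def by (simp only: UNIV_I simp_thms)
    finally show ?thesis .
  qed
  \<comment> \<open>The hypotheses concern \<open>n \<ge> 1\<close> only, and changing finitely many
    terms affects neither the upper nor the lower limit.\<close>
  have eq: "eventually (\<lambda>n. ereal (real n / (c n)\<^sup>2) *
      log_prob (measure (M n) {\<omega> \<in> space (M n). (S n \<omega> - real n * x) / c n \<in> B})
      = ereal (real n / (c n)\<^sup>2) * log_prob (mass n B / mass n UNIV)) sequentially"
    if "B \<in> sets borel" for B
    using eventually_ge_at_top[of 1] by eventually_elim (simp add: prob that)
  show ?thesis
    unfolding rate
  proof (intro conjI allI impI)
    fix F :: "real set" assume F: "closed F"
    show "limsup (\<lambda>n. ereal (real n / (c n)\<^sup>2) *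
        log_prob (measure (M n) {\<omega> \<in> space (M n). (S n \<omega> - real n * x) / c n \<in> F}))
      \<le> - (INF z\<in>F. ereal (\<kappa> * z\<^sup>2 / 2))"
      unfolding Limsup_eq[OF eq[OF borel_closed[OF F]]] by (rule limsup_closed_le[OF F])
  next
    fix G :: "real set" assume G: "open G"
    show "- (INF z\<in>G. ereal (\<kappa> * z\<^sup>2 / 2))
      \<le> liminf (\<lambda>n. ereal (real n / (c n)\<^sup>2) *
        log_prob (measure (M n) {\<omega> \<in> space (M n). (S n \<omega> - real n * x) / c n \<in> G}))"
      unfolding Liminf_eq[OF eq[OF borel_open[OF G]]] by (rule liminf_open_ge[OF G])
  qed
qed

end
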